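(* Consider the linear quadratic team model in the context with discount factor $\beta\in(0,1]$, and suppose: $Q$ and $\bar{\mathbf Q}$ are positive semi-definite, $R$ and $\bar{\mathbf R}$ are positive definite, $(A,B)$ and $(\bar{\mathbf A},\bar{\mathbf B})$ are stabilizable, and $(A,Q^{1/2})$ and $(\bar{\mathbf A},\bar{\mathbf Q}^{1/2})$ are detectable. Let $P$ and $\bar{\mathbf P}$ solve $$P=Q+\beta A^\top PA-\beta A^\top PB(B^\top PB+\beta^{-1}R)^{-1}B^\top PA,$$ $$\bar{\mathbf P}=\bar{\mathbf Q}+\beta\bar{\mathbf A}^\top\bar{\mathbf P}\bar{\mathbf A}-\beta\bar{\mathbf A}^\top\bar{\mathbf P}\bar{\mathbf B}(\bar{\mathbf B}^\top\bar{\mathbf P}\bar{\mathbf B}+\beta^{-1}\bar{\mathbf R})^{-1}\bar{\mathbf B}^\top\bar{\mathbf P}\bar{\mathbf A},$$ and set $\theta^*=-(B^\top PB+\beta^{-1}R)^{-1}B^\top PA$ and $\bar{\boldsymbol\theta}^*=-(\bar{\mathbf B}^\top\bar{\mathbf P}\bar{\mathbf B}+\beta^{-1}\bar{\mathbf R})^{-1}\bar{\mathbf B}^\top\bar{\mathbf P}\bar{\mathbf A}$, written in block rows as $\bar{\boldsymbol\theta}^*=[\bar\theta^{1,*};\ldots;\bar\theta^{z,*}]$ with $\bar\theta^{j,*}\in\mathbb{R}^{h_u\times zh_x}$. Then the strategy $$u^{i,*}_t=\theta^*x^i_t+\sum_{j=1}^z\alpha^{i,j}\big(\bar\theta^{j,*}\bar{\mathbf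 x}_t-\theta^*\bar x^j_t\big),\quad t\in\mathbb{N},\ i=1,\dots,n,$$ is optimal among all deep-state-sharing strategies for the cost $J_{n,\beta}$. Moreover, in the weakly coupled case (see context), the optimal strategy is $u^{i,*}_t=\theta^*x^i_t+\sum_{j=1}^z\alpha^{i,j}(\bar\theta^{j,*}-\theta^* )\bar x^j_t$, where for each $j$, $\bar\theta^{j,*}=-((B+\bar B^j)^\top\bar P^j(B+\bar B^j)+\beta^{-1}(R+\bar R^j))^{-1}(B+\bar B^j)^\top\bar P^j(A+\bar A^j)$ and $\bar P^j$ solves $\bar P^j=Q+\bar Q^j+\beta(A+\bar A^j)^\top\bar P^j(A+\bar A^j)-\beta(A+\bar A^j)^\top\bar P^j(B+\bar B^j)((B+\bar B^j)^\top\bar P^j(B+\bar B^j)+\beta^{-1}(R+\bar R^j))^{-1}(B+\bar B^j)^\top\bar P^j(A+\bar A^j)$.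
   Context: Model: $n$ agents; agent $i$ has state $x^i_t\in\mathbb{R}^{h_x}$, action $u^i_t\in\mathbb{R}^{h_u}$, noise $w^i_t\in\mathbb{R}^{h_x}$, $t\in\mathbb{N}$. Impact factors $\alpha^{i,j}\in\mathbb{R}$, $i\le n$, $j\le z$, satisfy $\frac1n\sum_{i=1}^n\alpha^{i,j}\alpha^{i,k}=\mathbb{1}\{j=k\}$. Deep state: $\bar x^j_t=\frac1n\sum_i\alpha^{i,j}x^i_t$, $\bar u^j_t=\frac1n\sum_i\alpha^{i,j}u^i_t$, $\bar{\mathbf x}_t=[\bar x^1_t;\ldots;\bar x^z_t]\in\mathbb{R}^{zh_x}$, $\bar{\mathbf u}_t=[\bar u^1_t;\ldots;\bar u^z_t]$. Dynamics: $x^i_{t+1}=Ax^i_t+Bu^i_t+\sum_{j=1}^z\alpha^{i,j}(\bar A^j\bar{\mathbf x}_t+\bar B^j\bar{\mathbf u}_t)+w^i_t$, with $\bar A^j\in\mathbb{R}^{h_x\times zh_x}$, $\bar B^j\in\mathbb{R}^{h_x\times zh_u}$. Initial states and noises have zero mean and covariances uniformly bounded in time, initial states and noises are mutually independent, and admissible actions are square integrable. Per-step cost: $c=(x^i_t)^\top Qx^i_t+(u^i_t)^\top Ru^i_t+\bar{\mathbf x}_t^\top\bar Q\bar{\mathbf x}_t+\bar{\mathbf u}_t^\top\bar R\bar{\mathbf u}_t$, with $Q,R,\bar Q,\bar R$ symmetric. Set $\bar{\mathbf A}=\mathrm{diag}(A,\ldots,A)+[\bar A^1;\ldots;\bar A^z]$,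 $\bar{\mathbf B}=\mathrm{diag}(B,\ldots,B)+[\bar B^1;\ldots;\bar B^z]$ (vertical stacking, $z$ diagonal blocks), $\bar{\mathbf Q}=\mathrm{diag}(Q,\ldots,Q)+\bar Q$, $\bar{\mathbf R}=\mathrm{diag}(R,\ldots,R)+\bar R$. A deep-state-sharing strategy $g=\{g^i_t\}$ has $u^i_t\sim g^i_t(\cdot\mid x^i_t,\bar{\mathbf x}_t)$. Cost: for $\beta\in(0,1)$, $J_{n,\beta}(g)=(1-\beta)\mathbb{E}^g[\frac1n\sum_i\sum_{t\ge1}\beta^{t-1}c_t^i]$; for $\beta=1$, $J_{n,1}(g)=\limsup_T\frac1T\mathbb{E}^g[\frac1n\sum_i\sum_{t=1}^Tc^i_t]$. Weakly coupled case: the coupling terms are instead $\sum_j\alpha^{i,j}(\bar A^j\bar x^j_t+\bar B^j\bar u^j_t)$ in the dynamics with $\bar A^j\in\mathbb{R}^{h_x\times h_x}$, $\bar B^j\in\mathbb{R}^{h_x\times h_u}$, and $\sum_j(\bar x^j_t)^\top\bar Q^j\bar x^j_t+(\bar u^j_t)^\top\bar R^j\bar u^j_t$ in the cost (so $\bar{\mathbf A},\bar{\mathbf B},\bar{\mathbf Q},\bar{\mathbf R}$ are block diagonal with blocks $A+\bar A^j$, $B+\bar B^j$, $Q+\bar Q^j$, $R+\bar R^j$).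
   Formalization: The Riccati solutions P, bold P-bar and (weakly coupled case) each P-bar^j are required to be symmetric positive semi-definite; for arbitrary solutions the claim fails (A=1/2, B=1, Q=0, R=1, beta=1 admits the solution -3/4, whose gain is destabilizing). *)

theory Defs
  imports "HOL-Probability.Probability"
begin

definition qf :: "real^'n^'n \<Rightarrow> real^'n \<Rightarrow> real" where
  "qf M x = x \<bullet> (M *v x)"

definition psd :: "real^'n^'n \<Rightarrow> bool" where
  "psd M \<longleftrightarrow> (\<forall>x. 0 \<le> qf M x)"

definition pd :: "real^'n^'n \<Rightarrow> bool" where
  "pd M \<longleftrightarrow> (\<forall>x. x \<noteq> 0 \<longrightarrow> 0 < qf M x)"

definition symm :: "real^'n^'n \<Rightarrow> bool" where
  "symm M \<longleftrightarrow> transpose M = M"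

definition msqrt :: "real^'n^'n \<Rightarrow> real^'n^'n" where
  "msqrt Q = (THE S. symm S \<and> psd S \<and> S ** S = Q)"

definition cmat :: "real^'n^'m \<Rightarrow> complex^'n^'m" where
  "cmat M = (\<chi> i j. complex_of_real (M $ i $ j))"

definition schur_stable :: "real^'n^'n \<Rightarrow> bool" where
  "schur_stable M \<longleftrightarrow> (\<forall>c::complex. det (mat c - cmat M) = 0 \<longrightarrow> cmod c < 1)"

definition stabilizable :: "real^'n^'n \<Rightarrow> real^'m^'n \<Rightarrow> bool" where
  "stabilizable A B \<longleftrightarrow> (\<exists>K :: real^'n^'m. schur_stable (A + B ** K))"

definition detectable :: "real^'n^'n \<Rightarrow> real^'n^'p \<Rightarrow> bool" where
  "detectable A C \<longleftrightarrow> (\<exists>L :: real^'p^'n. schur_stable (A + L ** C))"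

definition riccati :: "real \<Rightarrow> real^'n^'n \<Rightarrow> real^'m^'n \<Rightarrow> real^'n^'n \<Rightarrow> real^'m^'m
    \<Rightarrow> real^'n^'n \<Rightarrow> bool" where
  "riccati \<beta> A B Q R P \<longleftrightarrow>
     P = Q + \<beta> *\<^sub>R (transpose A ** P ** A)
         - \<beta> *\<^sub>R (transpose A ** P ** B
             ** matrix_inv (transpose B ** P ** B + (1 / \<beta>) *\<^sub>R R)
             ** transpose B ** P ** A)"

definition gain :: "real \<Rightarrow> real^'n^'n \<Rightarrow> real^'m^'n \<Rightarrow> real^'m^'m \<Rightarrow> real^'n^'n
    \<Rightarrow> real^'n^'m" where
  "gain \<beta> A B R P =
     - (matrix_inv (transpose B ** P ** B + (1 / \<beta>) *\<^sub>R R) ** transpose B ** P ** A)"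

section \<open>Block matrices (index ('z \<times> 'h) = block j, component a)\<close>

definition bdiagf :: "('z::finite \<Rightarrow> real^'a^'b) \<Rightarrow> real^('z \<times> 'a)^('z \<times> 'b)" where
  "bdiagf M = (\<chi> p q. if fst p = fst q then M (fst p) $ snd p $ snd q else 0)"

definition bdiag :: "real^'a^'b \<Rightarrow> real^('z::finite \<times> 'a)^('z \<times> 'b)" where
  "bdiag M = bdiagf (\<lambda>_. M)"

definition stack :: "('z::finite \<Rightarrow> real^'c^'b) \<Rightarrow> real^'c^('z \<times> 'b)" where
  "stack N = (\<chi> p. N (fst p) $ snd p)"

definition blk :: "real^('z::finite \<times> 'h::finite) \<Rightarrow> 'z \<Rightarrow> real^'h" where
  "blk v j = (\<chi> a. v $ (j, a))"

definition bold :: "real^'a^'b \<Rightarrow> ('z::finite \<Rightarrow> real^('z \<times> 'a)^'b) \<Rightarrow> real^('z \<times> 'a)^('z \<times> 'b)" where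
  "bold M N = bdiag M + stack N"

definition deep :: "('n::finite \<Rightarrow> 'z::finite \<Rightarrow> real) \<Rightarrow> ('n \<Rightarrow> real^'h) \<Rightarrow> real^('z \<times> 'h)" where
  "deep \<alpha> x = (\<chi> p. (\<Sum>i\<in>UNIV. \<alpha> i (fst p) * x i $ snd p) / real CARD('n))"

text \<open>Actions produced by a (randomized) deep-state-sharing strategy g:
  u^i_t = g t i (x^i_t) (xbar_t) (xi^i_t), with xi an independent randomization.\<close>
definition ctrl :: "('n::finite \<Rightarrow> 'z::finite \<Rightarrow> real) \<Rightarrow> (nat \<Rightarrow> 'n \<Rightarrow> 'w \<Rightarrow> real)
    \<Rightarrow> (nat \<Rightarrow> 'n \<Rightarrow> real^'hx \<Rightarrow> real^('z \<times> 'hx) \<Rightarrow> real \<Rightarrow> real^'hu)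
    \<Rightarrow> nat \<Rightarrow> ('n \<Rightarrow> real^'hx) \<Rightarrow> 'w \<Rightarrow> 'n \<Rightarrow> real^'hu" where
  "ctrl \<alpha> \<Xi> g t x \<omega> = (\<lambda>i. g t i (x i) (deep \<alpha> x) (\<Xi> t i \<omega>))"

text \<open>Closed-loop trajectory (time 0 here = time 1 in the paper). cpl j xbar ubar is the
  coupling term multiplying alpha(i,j) in the dynamics.\<close>
fun traj :: "real^'hx^'hx \<Rightarrow> real^'hu^'hx \<Rightarrow> ('n::finite \<Rightarrow> 'z::finite \<Rightarrow> real)
    \<Rightarrow> ('z \<Rightarrow> real^('z \<times> 'hx) \<Rightarrow> real^('z \<times> 'hu) \<Rightarrow> real^'hx)
    \<Rightarrow> ('n \<Rightarrow> 'w \<Rightarrow> real^'hx) \<Rightarrow> (nat \<Rightarrow> 'n \<Rightarrow> 'w \<Rightarrow> real^'hx) \<Rightarrow> (nat \<Rightarrow> 'n \<Rightarrow> 'w \<Rightarrow> real)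
    \<Rightarrow> (nat \<Rightarrow> 'n \<Rightarrow> real^'hx \<Rightarrow> real^('z \<times> 'hx) \<Rightarrow> real \<Rightarrow> real^'hu)
    \<Rightarrow> nat \<Rightarrow> 'w \<Rightarrow> 'n \<Rightarrow> real^'hx" where
  "traj A B \<alpha> cpl X0 W \<Xi> g 0 \<omega> = (\<lambda>i. X0 i \<omega>)"
| "traj A B \<alpha> cpl X0 W \<Xi> g (Suc t) \<omega> =
     (let x = traj A B \<alpha> cpl X0 W \<Xi> g t \<omega>; u = ctrl \<alpha> \<Xi> g t x \<omega>
      in (\<lambda>i. A *v x i + B *v u i + (\<Sum>j\<in>UNIV. \<alpha> i j *\<^sub>R cpl j (deep \<alpha> x) (deep \<alpha> u))
               + W t i \<omega>))"

definition acts where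
  "acts A B \<alpha> cpl X0 W \<Xi> g t \<omega> = ctrl \<alpha> \<Xi> g t (traj A B \<alpha> cpl X0 W \<Xi> g t \<omega>) \<omega>"

definition stage_cost :: "real^'hx^'hx \<Rightarrow> real^'hu^'hu \<Rightarrow> ('n::finite \<Rightarrow> 'z::finite \<Rightarrow> real)
    \<Rightarrow> (real^('z \<times> 'hx) \<Rightarrow> real^('z \<times> 'hu) \<Rightarrow> real)
    \<Rightarrow> ('n \<Rightarrow> real^'hx) \<Rightarrow> ('n \<Rightarrow> real^'hu) \<Rightarrow> real" where
  "stage_cost Q R \<alpha> cc x u =
     (\<Sum>i\<in>UNIV. qf Q (x i) + qf R (u i) + cc (deep \<alpha> x) (deep \<alpha> u)) / real CARD('n)"

definition Jcost where
  "Jcost M \<beta> A B \<alpha> cpl Q R cc X0 W \<Xi> g =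
     (let c = (\<lambda>t \<omega>. stage_cost Q R \<alpha> cc (traj A B \<alpha> cpl X0 W \<Xi> g t \<omega>)
                                          (acts A B \<alpha> cpl X0 W \<Xi> g t \<omega>))
      in if \<beta> < 1
         then ereal (1 - \<beta>) * (\<Sum>t. ereal (\<beta> ^ t * integral\<^sup>L M (c t)))
         else limsup (\<lambda>T. ereal (integral\<^sup>L M (\<lambda>\<omega>. \<Sum>t<T. c t \<omega>) / real T)))"

definition admissible where
  "admissible M A B \<alpha> cpl X0 W \<Xi> g \<longleftrightarrow>
     (\<forall>t i. (\<lambda>(x, xb, r). g t i x xb r) \<in> borel_measurable borel) \<and>
     (\<forall>t i. integrable M (\<lambda>\<omega>. (norm (acts A B \<alpha> cpl X0 W \<Xi> g t \<omega> i))\<^sup>2))"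

definition optimal where
  "optimal M \<beta> A B \<alpha> cpl Q R cc X0 W \<Xi> g \<longleftrightarrow>
     admissible M A B \<alpha> cpl X0 W \<Xi> g \<and>
     (\<forall>g'. admissible M A B \<alpha> cpl X0 W \<Xi> g' \<longrightarrow>
        Jcost M \<beta> A B \<alpha> cpl Q R cc X0 W \<Xi> g \<le> Jcost M \<beta> A B \<alpha> cpl Q R cc X0 W \<Xi> g')"

definition prim :: "('n::finite \<Rightarrow> 'w \<Rightarrow> real^'hx) \<Rightarrow> (nat \<Rightarrow> 'n \<Rightarrow> 'w \<Rightarrow> real^'hx)
    \<Rightarrow> nat option \<Rightarrow> 'w \<Rightarrow> real^'hx^'n" where
  "prim X0 W k \<omega> = (case k of None \<Rightarrow> (\<chi> i. X0 i \<omega>) | Some t \<Rightarrow> (\<chi> i. W t i \<omega>))"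

definition primitives_ok :: "'w measure \<Rightarrow> ('n::finite \<Rightarrow> 'w \<Rightarrow> real^'hx)
    \<Rightarrow> (nat \<Rightarrow> 'n \<Rightarrow> 'w \<Rightarrow> real^'hx) \<Rightarrow> (nat \<Rightarrow> 'n \<Rightarrow> 'w \<Rightarrow> real) \<Rightarrow> bool" where
  "primitives_ok M X0 W \<Xi> \<longleftrightarrow>
     (\<forall>i. X0 i \<in> borel_measurable M \<and> integrable M (\<lambda>\<omega>. (norm (X0 i \<omega>))\<^sup>2)
          \<and> integral\<^sup>L M (X0 i) = 0) \<and>
     (\<forall>t i. W t i \<in> borel_measurable M \<and> integrable M (\<lambda>\<omega>. (norm (W t i \<omega>))\<^sup>2)
          \<and> integral\<^sup>L M (W t i) = 0) \<and>
     (\<exists>C. \<forall>t i. integral\<^sup>L M (\<lambda>\<omega>. (norm (W t i \<omega>))\<^sup>2) \<le> C) \<and>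
     (\<forall>t i. \<Xi> t i \<in> borel_measurable M) \<and>
     prob_space.indep_sets M
       (\<lambda>k. case k of
              Inl p \<Rightarrow> {prim X0 W p -` S \<inter> space M | S. S \<in> sets borel}
            | Inr (t, i) \<Rightarrow> {\<Xi> t i -` S \<inter> space M | S. S \<in> sets borel}) UNIV"

definition gstar :: "('n \<Rightarrow> 'z::finite \<Rightarrow> real) \<Rightarrow> real^'hx^'hu \<Rightarrow> real^('z \<times> 'hx)^('z \<times> 'hu)
    \<Rightarrow> nat \<Rightarrow> 'n \<Rightarrow> real^'hx \<Rightarrow> real^('z \<times> 'hx) \<Rightarrow> real \<Rightarrow> real^'hu" where
  "gstar \<alpha> \<theta> \<theta>b t i x xb r =
     \<theta> *v x + (\<Sum>j\<in>UNIV. \<alpha> i j *\<^sub>R (blk (\<theta>b *v xb) j - \<theta> *v blk xb j))"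

definition gstar_weak :: "('n \<Rightarrow> 'z::finite \<Rightarrow> real) \<Rightarrow> real^'hx^'hu \<Rightarrow> ('z \<Rightarrow> real^'hx^'hu)
    \<Rightarrow> nat \<Rightarrow> 'n \<Rightarrow> real^'hx \<Rightarrow> real^('z \<times> 'hx) \<Rightarrow> real \<Rightarrow> real^'hu" where
  "gstar_weak \<alpha> \<theta> \<theta>b t i x xb r =
     \<theta> *v x + (\<Sum>j\<in>UNIV. \<alpha> i j *\<^sub>R ((\<theta>b j - \<theta>) *v blk xb j))"

end

theory Submission
  imports Defs "HOL-Computational_Algebra.Fundamental_Theorem_Algebra"
begin

text \<open>Orthonormality of the impact factors splits the team into n identical systems for the deviations
  \<open>x i - (\<Sum>j. \<alpha> i j *\<^sub>R xbar j)\<close> and one system for the deep state; dynamics and cost decouple along this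
  splitting. In each subsystem the Riccati solution satisfies a Bellman inequality, with equality at the
  gain, and the noise, being centred and independent of the past, contributes only a control-free term.
  Telescoping yields: the T-stage cost of the proposed strategy is at most that of any competitor plus
  the competitor's terminal value. Detectability bounds the terminal value by the past cost through a
  contracting quadratic function of the state, which makes the terminal term negligible.\<close>

section \<open>Quadratic forms and the Riccati equation\<close>

text \<open>A competitor may be nonlinear, randomized and destabilizing, so no closed-loop matrix is
  available for it: only its running cost can control its states. This is why the dissipation
  inequality must hold for arbitrary actions. The subsystems share noise and may be correlated, but
  cost and value are sums over them, so only expectations within one subsystem enter. The lower
  bound uses the information pattern only through independence of the current noise from the current
  state and action; sharing the deep state makes the proposed feedback implementable, since agent i
  recovers its own deviation from its state and the deep state. Both coupling models are treated at
  once: Riccati equations are reduced to Bellman relations, which pass from blocks to block-diagonal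
  matrices without inverting a block matrix.\<close>

lemma qf_add: "qf M (x + y) = qf M x + x \<bullet> (M *v y) + y \<bullet> (M *v x) + qf M y"
  by (simp add: qf_def matrix_vector_right_distrib inner_add_left inner_add_right)

lemma symm_inner: "symm M \<Longrightarrow> x \<bullet> (M *v y) = y \<bullet> (M *v x)"
  unfolding symm_def by (metis dot_lmul_matrix inner_commute transpose_matrix_vector)

lemma matrix_vector_mult_minus: "(- A) *v x = - (A *v (x::real^'n))"
  by (simp add: vec_eq_iff matrix_vector_mult_def sum_negf)

lemma inner_vector_matrix: "x \<bullet> (y v* A) = y \<bullet> (A *v (x::real^'n))"
  by (metis dot_lmul_matrix inner_commute)

lemma norm_mult_vec_le: "\<exists>K\<ge>0. \<forall>x. norm (M *v x) \<le> K * norm (x::real^'n)"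
proof -
  have "bounded_linear ((*v) M)" by (rule matrix_vector_mul_bounded_linear)
  from bounded_linear.nonneg_bounded[OF this] show ?thesis
    by (metis mult.commute)
qed

lemma qf_le: "\<exists>K\<ge>0. \<forall>x. qf M x \<le> K * (norm x)\<^sup>2"
proof -
  obtain K where K: "K \<ge> 0" "\<And>x. norm (M *v x) \<le> K * norm x" using norm_mult_vec_le by blast
  have "qf M x \<le> K * (norm x)\<^sup>2" for x
  proof -
    have "qf M x \<le> norm x * norm (M *v x)" unfolding qf_def by (rule norm_cauchy_schwarz)
    also have "\<dots> \<le> norm x * (K * norm x)" by (intro mult_left_mono K) simp
    finally show ?thesis by (simp add: power2_eq_square algebra_simps)
  qed
  with K show ?thesis by blast
qed

lemma continuous_on_qf: "continuous_on S (qf M)"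
  unfolding qf_def by (intro continuous_intros matrix_vector_mult_linear_continuous_on)

text \<open>Compactness of the unit sphere gives \<open>qf R\<close> a positive minimum there, and
  homogeneity of degree two spreads it to all vectors. Control energy can thus be paid for by the
  stage cost.\<close>

lemma pd_lower_bound:
  assumes "pd R" shows "\<exists>K\<ge>0. \<forall>u. (norm u)\<^sup>2 \<le> K * qf R u"
proof -
  let ?S = "sphere (0::real^'a) 1"
  obtain b :: "real^'a" where "b \<in> Basis" using nonempty_Basis by blast
  then have ne: "?S \<noteq> {}" by (force)
  obtain w where w: "w \<in> ?S" "\<And>y. y \<in> ?S \<Longrightarrow> qf R w \<le> qf R y"
    using continuous_attains_inf[OF compact_sphere ne continuous_on_qf[of _ R]] by blast
  have "w \<noteq> 0" using w(1) by auto
  with assms have m: "qf R w > 0" by (simp add: pd_def)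
  have "(norm u)\<^sup>2 \<le> (1 / qf R w) * qf R u" for u
  proof (cases "u = 0")
    case False
    then have "(1 / norm u) *\<^sub>R u \<in> ?S" by simp
    from w(2)[OF this] have "qf R w \<le> (1 / norm u)\<^sup>2 * qf R u"
      by (simp add: qf_def matrix_vector_mult_scaleR power2_eq_square)
    then show ?thesis using False m by (simp add: field_simps)
  qed (simp add: qf_def)
  with m show ?thesis by (intro exI[of _ "1 / qf R w"]) auto
qed

lemma pd_imp_psd: "pd R \<Longrightarrow> psd R"
  unfolding psd_def pd_def by (metis inner_zero_left order_le_less qf_def)

text \<open>This is all that the optimality argument retains of the Riccati equation. Being free of
  inverses, it can be summed over the blocks of a block-diagonal system.\<close>

definition bellman where
  "bellman \<beta> A B Q R P \<theta> \<longleftrightarrow>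
     (\<forall>x u. qf P x \<le> qf Q x + qf R u + \<beta> * qf P (A *v x + B *v u)) \<and>
     (\<forall>x. qf P x = qf Q x + qf R (\<theta> *v x) + \<beta> * qf P (A *v x + B *v (\<theta> *v x)))"

text \<open>Completing the square: the cost of an action plus the discounted next value exceeds
  \<open>qf P x\<close> by \<open>\<beta> * qf H (u - \<theta> *v x)\<close>, where \<open>H\<close>
  is the matrix inverted in the gain.\<close>

lemma riccati_bellman:
  assumes "0 < \<beta>" "symm R" "pd R" "symm P" "psd P" "riccati \<beta> A B Q R P"
  shows "bellman \<beta> A B Q R P (gain \<beta> A B R P)"
proof -
  define H where "H = transpose B ** P ** B + (1 / \<beta>) *\<^sub>R R"
  define \<theta> where "\<theta> = gain \<beta> A B R P"
  have Hv: "H *v u = transpose B *v (P *v (B *v u)) + (1 / \<beta>) *\<^sub>R (R *v u)" for u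
    by (simp add: H_def matrix_vector_mult_add_rdistrib scaleR_matrix_vector_assoc[symmetric]
        matrix_vector_mul_assoc[symmetric])
  have uH: "u \<bullet> (H *v v) = (B *v u) \<bullet> (P *v (B *v v)) + (1 / \<beta>) * (u \<bullet> (R *v v))" for u v
    by (simp add: Hv inner_add_right inner_vector_matrix inner_commute)
  then have qH: "qf H u = qf P (B *v u) + (1 / \<beta>) * qf R u" for u
    by (simp add: qf_def)
  have "0 < qf H u" if "u \<noteq> 0" for u
    using that assms unfolding qH psd_def pd_def by (simp add: add_nonneg_pos)
  then have pdH: "pd H" and "psd H" by (auto simp: pd_def intro!: pd_imp_psd)
  \<comment> \<open>A positive definite matrix has trivial kernel, so the \<open>matrix_inv\<close>
    in the gain is a genuine inverse.\<close>
  have "\<And>x. H *v x = 0 \<Longrightarrow> x = 0"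
    using pdH unfolding pd_def qf_def by (metis inner_zero_right less_irrefl)
  then have "invertible H"
    by (simp add: invertible_left_inverse matrix_left_invertible_ker)
  then have H_inv: "H *v (matrix_inv H *v x) = x" for x
    using someI_ex[of "\<lambda>G. H ** G = mat 1 \<and> G ** H = mat 1"]
    by (simp add: matrix_vector_mul_assoc matrix_inv_def invertible_def)
  have \<theta>: "\<theta> = - (matrix_inv H ** transpose B ** P ** A)"
    by (simp add: \<theta>_def gain_def H_def)
  have H\<theta>: "H *v (\<theta> *v x) = - (transpose B *v (P *v (A *v x)))" for x
    unfolding \<theta> by (simp add: matrix_vector_mult_minus matrix_vector_mul_assoc[symmetric] H_inv vec.neg)
  have PBH: "(A *v x) \<bullet> (P *v (B *v u)) = - (u \<bullet> (H *v (\<theta> *v x)))" for x u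
    unfolding H\<theta> using symm_inner[OF \<open>symm P\<close>, of "A *v x" "B *v u"]
    by (simp add: inner_vector_matrix inner_commute)
  \<comment> \<open>The Riccati equation as a quadratic form, its last term rewritten through
    \<open>\<theta>\<close>, whose sign absorbs the minus.\<close>
  have PP: "qf P x = qf Q x + \<beta> * qf P (A *v x) + \<beta> * ((A *v x) \<bullet> (P *v (B *v (\<theta> *v x))))" for x
  proof -
    have "P = Q + \<beta> *\<^sub>R (transpose A ** P ** A)
         - \<beta> *\<^sub>R (transpose A ** P ** B ** (matrix_inv H ** transpose B ** P ** A))"
      using assms(6) unfolding riccati_def H_def by (simp add: matrix_mul_assoc)
    then have "P *v x = (Q + \<beta> *\<^sub>R (transpose A ** P ** A)
         - \<beta> *\<^sub>R (transpose A ** P ** B ** (matrix_inv H ** transpose B ** P ** A))) *v x"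
      by (rule arg_cong)
    also have "\<dots> = Q *v x + \<beta> *\<^sub>R (transpose A *v (P *v (A *v x)))
          + \<beta> *\<^sub>R (transpose A *v (P *v (B *v (\<theta> *v x))))"
      unfolding \<theta>
      by (simp add: matrix_vector_mult_add_rdistrib matrix_vector_mult_diff_rdistrib matrix_vector_mult_minus
         scaleR_matrix_vector_assoc[symmetric] matrix_vector_mul_assoc[symmetric] vec.neg)
    finally show ?thesis
      unfolding qf_def by (simp add: inner_add_right inner_vector_matrix inner_commute)
  qed
  have main: "qf Q x + qf R u + \<beta> * qf P (A *v x + B *v u) = qf P x + \<beta> * qf H (u - \<theta> *v x)" for x u
  proof -
    have "(u \<bullet> (H *v (\<theta> *v x))) = (\<theta> *v x) \<bullet> (H *v u)"
      using symm_inner[OF \<open>symm P\<close>, of "B *v u" "B *v (\<theta> *v x)"] symm_inner[OF \<open>symm R\<close>, of u "\<theta> *v x"]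
      by (simp add: uH)
    then have e2: "qf H (u - \<theta> *v x) = qf H u - 2 * (u \<bullet> (H *v (\<theta> *v x))) + (\<theta> *v x) \<bullet> (H *v (\<theta> *v x))"
      by (simp add: qf_def matrix_vector_mult_diff_distrib inner_diff_left inner_diff_right)
    have e3: "qf P (A *v x + B *v u) = qf P (A *v x) - 2 * (u \<bullet> (H *v (\<theta> *v x))) + qf P (B *v u)"
      using symm_inner[OF \<open>symm P\<close>, of "B *v u" "A *v x"] PBH[of x u] by (simp add: qf_add)
    have "\<beta> * qf H u = \<beta> * qf P (B *v u) + qf R u"
      using \<open>0 < \<beta>\<close> by (simp add: qH distrib_left)
    then show ?thesis
      unfolding e2 e3 using PP[of x] unfolding PBH by (simp add: algebra_simps)
  qed
  show ?thesis unfolding bellman_def \<theta>_def[symmetric] main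
    using \<open>psd H\<close> \<open>0 < \<beta>\<close> by (auto simp: psd_def qf_def)
qed

section \<open>Square roots of positive semi-definite matrices\<close>

text \<open>Take a maximal orthonormal family of eigenvectors. If its orthogonal complement were nonzero,
  a maximizer of the quadratic form on the unit sphere of the complement would be a further eigenvector.\<close>

lemma rayleigh_eigenvector:
  fixes Q :: "real^'n^'n"
  assumes "symm Q" and V: "subspace V" and inv: "\<And>x. x \<in> V \<Longrightarrow> Q *v x \<in> V" and "V \<noteq> {0}"
  obtains v l where "v \<in> V" "norm v = 1" "Q *v v = l *\<^sub>R v"
proof -
  let ?S = "V \<inter> sphere 0 1"
  have "compact ?S" using closed_subspace[OF V] by (simp add: closed_Int_compact)
  obtain x where "x \<in> V" "x \<noteq> 0" using V \<open>V \<noteq> {0}\<close> subspace_0 by blast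
  then have "(1 / norm x) *\<^sub>R x \<in> ?S" using V by (auto simp: subspace_scale)
  then have ne: "?S \<noteq> {}" by blast
  obtain v where v: "v \<in> ?S" "\<And>y. y \<in> ?S \<Longrightarrow> qf Q y \<le> qf Q v"
    using continuous_attains_sup[OF \<open>compact ?S\<close> ne continuous_on_qf[of _ Q]] by blast
  define l where "l = qf Q v"
  have "v \<in> V" "norm v = 1" using v(1) by auto
  then have "v \<bullet> v = 1" by (simp add: norm_eq_1)
  have up: "qf Q y \<le> l * (y \<bullet> y)" if "y \<in> V" for y
  proof (cases "y = 0")
    case False
    then have "(1 / norm y) *\<^sub>R y \<in> ?S" using V that by (auto simp: subspace_scale)
    from v(2)[OF this] have "(1 / norm y)\<^sup>2 * qf Q y \<le> l"
      by (simp add: qf_def matrix_vector_mult_scaleR power2_eq_square l_def)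
    then show ?thesis using False by (simp add: field_simps power2_norm_eq_inner)
  qed (simp add: qf_def)
  \<comment> \<open>The residual of \<open>v\<close> as an eigenvector for its Rayleigh quotient; it
    lies in \<open>V\<close> and is orthogonal to \<open>v\<close>.\<close>
  define w where "w = Q *v v - l *\<^sub>R v"
  have "w \<in> V" unfolding w_def using V \<open>v \<in> V\<close> inv by (simp add: subspace_diff subspace_scale)
  have vw: "v \<bullet> w = 0" by (simp add: w_def inner_diff_right l_def qf_def[symmetric] \<open>v \<bullet> v = 1\<close>)
  have Qvw: "v \<bullet> (Q *v w) = w \<bullet> w"
    using symm_inner[OF \<open>symm Q\<close>, of v w] vw
    by (simp add: w_def inner_diff_right inner_diff_left inner_commute)
  have ineq: "2 * t * (w \<bullet> w) \<le> t\<^sup>2 * (l * (w \<bullet> w) - qf Q w)" for t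
  proof -
    have "v + t *\<^sub>R w \<in> V" using V \<open>v \<in> V\<close> \<open>w \<in> V\<close> by (simp add: subspace_add subspace_scale)
    from up[OF this] have "qf Q v + 2 * t * (w \<bullet> w) + t\<^sup>2 * qf Q w \<le> l * (1 + t\<^sup>2 * (w \<bullet> w))"
      using symm_inner[OF \<open>symm Q\<close>, of v w] vw Qvw \<open>v \<bullet> v = 1\<close>
      by (simp add: qf_add qf_def matrix_vector_mult_scaleR inner_add_left inner_add_right inner_commute
          power2_eq_square algebra_simps)
    then show ?thesis by (simp add: l_def algebra_simps)
  qed
  have "w \<bullet> w = 0"
  proof (rule ccontr)
    assume "w \<bullet> w \<noteq> 0"
    then have p: "w \<bullet> w > 0" by (simp add: less_le)
    \<comment> \<open>With step \<open>(w \<bullet> w) / c\<close> along \<open>w\<close>, the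
      first-order gain outweighs the second-order loss, whose coefficient is at most
      \<open>c\<close>; the added 1 keeps \<open>c\<close> positive.\<close>
    define c where "c = \<bar>l * (w \<bullet> w) - qf Q w\<bar> + 1"
    have c: "c > 0" by (simp add: c_def)
    have "2 * ((w \<bullet> w) / c) * (w \<bullet> w) \<le> ((w \<bullet> w) / c)\<^sup>2 * (l * (w \<bullet> w) - qf Q w)" by (rule ineq)
    also have "\<dots> \<le> ((w \<bullet> w) / c)\<^sup>2 * c" by (intro mult_left_mono) (auto simp: c_def)
    finally have "2 * ((w \<bullet> w)\<^sup>2 / c) \<le> (w \<bullet> w)\<^sup>2 / c"
      using c by (simp add: power2_eq_square field_simps)
    moreover have "(w \<bullet> w)\<^sup>2 / c > 0" using p c by (intro divide_pos_pos zero_less_power)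
    ultimately show False by linarith
  qed
  then have "Q *v v = l *\<^sub>R v" by (simp add: w_def)
  then show ?thesis using that \<open>v \<in> V\<close> \<open>norm v = 1\<close> by blast
qed

lemma symm_eigenbasis:
  fixes Q :: "real^'n^'n"
  assumes "symm Q"
  obtains E l where "finite E" "pairwise orthogonal E" "\<And>v. v \<in> E \<Longrightarrow> norm v = 1"
    "span E = UNIV" "\<And>v. v \<in> E \<Longrightarrow> Q *v v = l v *\<^sub>R v"
proof -
  define good where "good E \<longleftrightarrow> pairwise orthogonal E \<and> (\<forall>v\<in>E. norm v = 1 \<and> (\<exists>l. Q *v v = l *\<^sub>R v))"
    for E
  have bound: "finite E \<and> card E \<le> DIM(real^'n)" if "good E" for E
  proof -
    have "0 \<notin> E" using that by (auto simp: good_def)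
    then have "independent E" using that pairwise_orthogonal_independent by (auto simp: good_def)
    then show ?thesis using independent_bound by blast
  qed
  have "good {}" by (simp add: good_def)
  \<comment> \<open>Orthonormal families are independent, so the dimension bounds their cardinality
    and a largest one exists.\<close>
  then obtain E where E: "good E" and max: "\<And>E'. good E' \<Longrightarrow> card E' \<le> card E"
    using ex_has_greatest_nat[of good "{}" card "DIM(real^'n) + 1"] bound by (metis Suc_eq_plus1 le_imp_less_Suc)
  define V where "V = {x. \<forall>v\<in>E. x \<bullet> v = 0}"
  have V: "subspace V" by (auto simp: V_def subspace_def inner_add_left)
  have inv: "Q *v x \<in> V" if "x \<in> V" for x
  proof -
    have "(Q *v x) \<bullet> v = 0" if "v \<in> E" for v
    proof -
      obtain l where "Q *v v = l *\<^sub>R v" using E \<open>v \<in> E\<close> by (auto simp: good_def)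
      then show ?thesis using symm_inner[OF assms, of v x] \<open>x \<in> V\<close> \<open>v \<in> E\<close>
        by (simp add: V_def inner_commute)
    qed
    then show ?thesis by (simp add: V_def)
  qed
  have V0: "V = {0}"
  proof (rule ccontr)
    assume "V \<noteq> {0}"
    then obtain v l where v: "v \<in> V" "norm v = 1" "Q *v v = l *\<^sub>R v"
      using rayleigh_eigenvector[OF assms V inv] by blast
    have "v \<notin> E" using v(1,2) by (auto simp: V_def)
    have "good (insert v E)" using E v
      by (auto simp: good_def pairwise_insert V_def orthogonal_def inner_commute)
    from max[OF this] show False using \<open>v \<notin> E\<close> bound[OF E] by simp
  qed
  have "span E = UNIV"
  proof (rule ccontr)
    assume "span E \<noteq> UNIV"
    then obtain x where "x \<noteq> 0" "\<And>y. y \<in> span E \<Longrightarrow> orthogonal x y"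
      using orthogonal_to_subspace_exists_gen[of E UNIV] by (auto simp: psubset_eq)
    then have "x \<in> V" by (auto simp: V_def orthogonal_def span_base)
    then show False using V0 \<open>x \<noteq> 0\<close> by simp
  qed
  moreover obtain l where "\<And>v. v \<in> E \<Longrightarrow> Q *v v = l v *\<^sub>R v"
    using E unfolding good_def by metis
  ultimately show ?thesis using that E bound[OF E] unfolding good_def by blast
qed

lemma symm_if_inner:
  fixes S :: "real^'n^'n"
  assumes "\<And>x y. x \<bullet> (S *v y) = y \<bullet> (S *v x)" shows "symm S"
proof -
  have "transpose S *v x = S *v x" for x
  proof -
    have "y \<bullet> (transpose S *v x) = y \<bullet> (S *v x)" for y
      using assms[of x y] by (simp add: inner_vector_matrix)
    then show ?thesis using vector_eq_ldot by blast
  qed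
  then show ?thesis unfolding symm_def by (simp add: matrix_eq del: transpose_matrix_vector)
qed

lemma psd_sqrt_exists:
  fixes Q :: "real^'n^'n"
  assumes "symm Q" "psd Q"
  shows "\<exists>S. symm S \<and> psd S \<and> S ** S = Q"
proof -
  obtain E l where E: "finite E" "pairwise orthogonal E" "\<And>v. v \<in> E \<Longrightarrow> norm v = 1"
    "span E = UNIV" "\<And>v. v \<in> E \<Longrightarrow> Q *v v = l v *\<^sub>R v"
    using symm_eigenbasis[OF assms(1)] by metis
  have orth: "v \<bullet> w = (if v = w then 1 else 0)" if "v \<in> E" "w \<in> E" for v w
    using that E(2,3) by (auto simp: pairwise_def orthogonal_def norm_eq_1)
  have l: "l v \<ge> 0" if "v \<in> E" for v
    using assms(2) E(5)[OF that] orth[OF that that] by (auto simp: psd_def qf_def dest!: spec[of _ v])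
  \<comment> \<open>Spectral definition: \<open>f\<close> scales each basis eigenvector by the
    square root of its eigenvalue.\<close>
  define f where "f x = (\<Sum>v\<in>E. (sqrt (l v) * (x \<bullet> v)) *\<^sub>R v)" for x
  have "linear f" unfolding f_def
    by (intro linear_compose_sum ballI) (auto intro!: linearI simp: inner_add_left algebra_simps)
  define S where "S = matrix f"
  have S: "S *v x = f x" for x using \<open>linear f\<close> by (simp add: S_def matrix_works)
  have in_f: "y \<bullet> f x = (\<Sum>v\<in>E. sqrt (l v) * (x \<bullet> v) * (y \<bullet> v))" for x y
    by (simp add: f_def inner_sum_right)
  have fv: "f v = sqrt (l v) *\<^sub>R v" if "v \<in> E" for v
  proof -
    have "f v = (\<Sum>w\<in>E. if w = v then sqrt (l v) *\<^sub>R v else 0)"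
      unfolding f_def by (intro sum.cong) (auto simp: orth that)
    then show ?thesis using that E(1) by simp
  qed
  have "symm S" by (rule symm_if_inner) (simp add: S in_f algebra_simps)
  moreover have "psd S"
    unfolding psd_def qf_def S in_f mult.assoc by (intro allI sum_nonneg, rule mult_nonneg_nonneg) (simp_all add: l)
  moreover have "S ** S = Q"
  proof -
    have "(S ** S) *v x = Q *v x" for x
    proof (rule linear_eq_on[where B = E and f = "(*v) (S ** S)" and g = "(*v) Q"])
      show "linear ((*v) (S ** S))" "linear ((*v) Q)" by simp_all
      show "x \<in> span E" using E(4) by simp
      show "(S ** S) *v v = Q *v v" if "v \<in> E" for v
        using that l[OF that] E(5)[OF that]
        by (simp add: matrix_vector_mul_assoc[symmetric] S fv linear_scale[OF \<open>linear f\<close>])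
    qed
    then show ?thesis by (simp add: matrix_eq)
  qed
  ultimately show ?thesis by blast
qed

text \<open>Factor the square of \<open>S\<close> minus \<open>l\<close> as (S + sqrt l)(S - sqrt
  l): for \<open>l\<close> nonzero, a nonzero residual \<open>w\<close> would be an eigenvector for
  minus sqrt l, which positive semi-definiteness forbids. A root is thus determined on every
  eigenvector of its square.\<close>

lemma psd_sqrt_eigenvector:
  fixes S :: "real^'n^'n"
  assumes "symm S" "psd S" "S *v (S *v v) = l *\<^sub>R v" "0 \<le> l"
  shows "S *v v = sqrt l *\<^sub>R v"
proof (cases "l = 0")
  case True
  have "(S *v v) \<bullet> (S *v v) = 0" using symm_inner[OF assms(1), of "S *v v" v] assms(3) True by simp
  then show ?thesis using True by simp
next
  case False
  define w where "w = S *v v - sqrt l *\<^sub>R v"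
  have "S *v w = - (sqrt l *\<^sub>R w)" using assms(3,4)
    by (simp add: w_def matrix_vector_mult_diff_distrib matrix_vector_mult_scaleR scaleR_diff_right)
  then have "qf S w = - sqrt l * (w \<bullet> w)" by (simp add: qf_def)
  moreover have "qf S w \<ge> 0" using assms(2) by (simp add: psd_def)
  ultimately have "w \<bullet> w \<le> 0" using False \<open>0 \<le> l\<close>
    by (simp add: mult_le_0_iff)
  then have "w = 0" using inner_ge_zero[of w] by (simp del: inner_ge_zero)
  then show ?thesis by (simp add: w_def)
qed

text \<open>\<open>msqrt\<close> is a definite description, so uniqueness matters as much as
  existence: any two roots agree on an eigenbasis of \<open>Q\<close>.\<close>

lemma msqrt_works:
  fixes Q :: "real^'n^'n"
  assumes "symm Q" "psd Q"
  shows "symm (msqrt Q) \<and> psd (msqrt Q) \<and> msqrt Q ** msqrt Q = Q"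
  unfolding msqrt_def
proof (rule theI')
  obtain S where S: "symm S" "psd S" "S ** S = Q" using psd_sqrt_exists[OF assms] by blast
  obtain E l where E: "\<And>v. v \<in> E \<Longrightarrow> norm v = 1" "span E = UNIV" "\<And>v. v \<in> E \<Longrightarrow> Q *v v = l v *\<^sub>R v"
    using symm_eigenbasis[OF assms(1)] by metis
  have l: "l v \<ge> 0" if "v \<in> E" for v
    using assms(2) E(1)[OF that] E(3)[OF that] by (auto simp: psd_def qf_def norm_eq_1 dest!: spec[of _ v])
  have "T = S" if T: "symm T" "psd T" "T ** T = Q" for T
  proof -
    have "T *v x = S *v x" for x
    proof (rule linear_eq_on[where B = E and f = "(*v) T" and g = "(*v) S"])
      show "linear ((*v) T)" "linear ((*v) S)" by simp_all
      show "x \<in> span E" using E(2) by simp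
      show "T *v v = S *v v" if "v \<in> E" for v
        using psd_sqrt_eigenvector[OF T(1,2) _ l[OF that]] psd_sqrt_eigenvector[OF S(1,2) _ l[OF that]]
          E(3)[OF that] T(3) S(3) by (simp add: matrix_vector_mul_assoc)
    qed
    then show ?thesis by (simp add: matrix_eq)
  qed
  with S show "\<exists>!S. symm S \<and> psd S \<and> S ** S = Q" by blast
qed

text \<open>Identifies the output energy in the detectability hypothesis with the state part of the
  stage cost.\<close>

lemma norm_msqrt_mult:
  assumes "symm Q" "psd Q" shows "(norm (msqrt Q *v x))\<^sup>2 = qf Q x"
proof -
  have "(msqrt Q *v x) \<bullet> (msqrt Q *v x) = x \<bullet> (msqrt Q *v (msqrt Q *v x))"
    using msqrt_works[OF assms] by (intro symm_inner) simp
  then show ?thesis using msqrt_works[OF assms]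
    by (simp add: power2_norm_eq_inner qf_def matrix_vector_mul_assoc)
qed

section \<open>Schur stability and dissipation\<close>

text \<open>This is p(G) v in Horner form. Working on vectors lets annihilating polynomials of
  single vectors replace the minimal polynomial of the matrix.\<close>

definition peval :: "complex^'n^'n \<Rightarrow> complex poly \<Rightarrow> complex^'n \<Rightarrow> complex^'n" where
  "peval G p v = fold_coeffs (\<lambda>a w. a *s v + G *v w) p 0"

lemma peval_0 [simp]: "peval G 0 v = 0"
  by (simp add: peval_def)

lemma peval_pCons [simp]: "peval G (pCons a p) v = a *s v + G *v peval G p v"
  by (cases "a = 0 \<and> p = 0") (auto simp: peval_def)

lemma peval_add: "peval G (p + q) v = peval G p v + peval G q v"
  by (induction p q rule: poly_induct2)
     (simp_all add: matrix_vector_right_distrib vector_sadd_rdistrib)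

lemma peval_smult: "peval G (smult a p) v = a *s peval G p v"
  by (induction p) (simp_all add: vector_add_ldistrib vector_smult_assoc vec.scale)

lemma peval_sum: "peval G (sum f S) v = (\<Sum>i\<in>S. peval G (f i) v)"
  by (induction S rule: infinite_finite_induct) (simp_all add: peval_add)

lemma peval_monom: "peval G (monom a k) v = a *s (((*v) G) ^^ k) v"
  by (induction k) (simp_all add: monom_0 monom_Suc vec.scale)

lemma peval_commute: "peval G p (G *v v) = G *v peval G p v"
  by (induction p) (simp_all add: vec.add vec.scale)

lemma peval_vec_add: "peval G p (v + w) = peval G p v + peval G p w"
  by (induction p) (simp_all add: vec.add vec.scale vector_add_ldistrib)

lemma peval_vec_scale: "peval G p (c *s v) = c *s peval G p v"
  by (induction p) (simp_all add: vec.add vec.scale vector_add_ldistrib vector_smult_assoc mult.commute)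

text \<open>More iterates of \<open>v\<close> than the real dimension of the space are linearly
  dependent; the coefficients of the relation form the polynomial.\<close>

lemma annihilating_poly:
  fixes G :: "complex^'n^'n"
  obtains p where "p \<noteq> 0" "peval G p v = 0"
proof -
  define N where "N = DIM(complex^'n)"
  define g where "g k = (((*v) G) ^^ k) v" for k
  show ?thesis
  \<comment> \<open>Dependence concerns the set of iterates, so a repeated iterate is treated
    separately: there a difference of two monomials annihilates \<open>v\<close>.\<close>
  proof (cases "inj_on g {..N}")
    case False
    then obtain i j where "i \<noteq> j" "g i = g j" by (auto simp: inj_on_def)
    have "monom (1::complex) i + monom (-1) j \<noteq> 0"
    proof
      assume "monom (1::complex) i + monom (-1) j = 0"
      then have "coeff (monom (1::complex) i + monom (-1) j) i = 0" by simp
      then show False using \<open>i \<noteq> j\<close> by simp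
    qed
    moreover have "peval G (monom 1 i + monom (-1) j) v = 0"
      using \<open>g i = g j\<close> by (simp add: peval_add peval_monom g_def)
    ultimately show ?thesis by (rule that)
  next
    case True
    then have "card (g ` {..N}) > DIM(complex^'n)" by (simp add: card_image N_def)
    then have "dependent (g ` {..N})" by (intro dependent_biggerset) simp
    then obtain u where u: "\<exists>w\<in>g ` {..N}. u w \<noteq> 0" "(\<Sum>w\<in>g ` {..N}. u w *\<^sub>R w) = 0"
      by (auto simp: dependent_finite)
    then obtain k where k: "k \<le> N" "u (g k) \<noteq> 0" by auto
    define p where "p = (\<Sum>i\<le>N. monom (complex_of_real (u (g i))) i)"
    have "coeff p k = complex_of_real (u (g k))"
      using k(1) by (simp add: p_def coeff_sum)
    then have "p \<noteq> 0" using k(2) by auto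
    moreover have "peval G p v = (\<Sum>i\<le>N. u (g i) *\<^sub>R g i)"
      by (simp add: p_def peval_sum peval_monom g_def[symmetric] vec_eq_iff)
         (simp add: scaleR_conv_of_real)
    then have "peval G p v = 0" using u(2) True by (simp add: sum.reindex)
    ultimately show ?thesis by (rule that)
  qed
qed

text \<open>Once the input is below \<open>d\<close>, the sequence is driven towards the level
  \<open>d / (1 - \<rho>)\<close>, chosen as half the tolerance. Serves both matrix powers and the
  discounted state energy.\<close>

lemma contracting_recursion_tendsto_0:
  fixes y e :: "nat \<Rightarrow> real"
  assumes "0 \<le> \<rho>" "\<rho> < 1" "\<And>k. 0 \<le> y k" "\<And>k. y (Suc k) \<le> \<rho> * y k + e k" "e \<longlonglongrightarrow> 0"
  shows "y \<longlonglongrightarrow> 0"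
proof (rule LIMSEQ_I)
  fix r :: real assume "0 < r"
  define d where "d = (1 - \<rho>) * r / 2"
  have "0 < d" using assms(2) \<open>0 < r\<close> by (simp add: d_def)
  then obtain k0 where k0: "\<And>k. k \<ge> k0 \<Longrightarrow> e k < d"
    using LIMSEQ_D[OF assms(5), of d] by force
  have b: "y (k0 + k) \<le> \<rho> ^ k * y k0 + r / 2" for k
  proof (induction k)
    case (Suc k)
    have "y (k0 + Suc k) \<le> \<rho> * y (k0 + k) + d" using assms(4)[of "k0 + k"] k0[of "k0 + k"] by simp
    also have "\<dots> \<le> \<rho> * (\<rho> ^ k * y k0 + r / 2) + d" using Suc assms(1) by (simp add: mult_left_mono)
    also have "\<dots> = \<rho> ^ Suc k * y k0 + r / 2" by (simp add: d_def field_simps)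
    finally show ?case .
  qed (use \<open>0 < r\<close> in simp)
  have "(\<lambda>k. \<rho> ^ k * y k0) \<longlonglongrightarrow> 0 * y k0" using assms by (intro tendsto_mult LIMSEQ_realpow_zero tendsto_const) auto
  then obtain k1 where k1: "\<And>k. k \<ge> k1 \<Longrightarrow> \<rho> ^ k * y k0 < r / 2"
    using LIMSEQ_D[of _ 0 "r/2"] \<open>0 < r\<close> by force
  have "norm (y k - 0) < r" if "k \<ge> k0 + k1" for k
    using b[of "k - k0"] k1[of "k - k0"] that assms(3)[of k] by (simp add: le_diff_conv2)
  then show "\<exists>no. \<forall>k\<ge>no. norm (y k - 0) < r" by blast
qed

text \<open>Induction on the degree: if l is a root of p with cofactor q, then either q already annihilates v,
  or q(G) v is an eigenvector for l. In the latter case the modulus of l is less than 1 and the powers of G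
  at v obey a contracting recursion driven by those at (G - l) v, which q annihilates.\<close>

lemma powers_tendsto_0_aux:
  fixes G :: "complex^'n^'n"
  assumes stable: "\<And>c w. G *v w = c *s w \<Longrightarrow> w \<noteq> 0 \<Longrightarrow> cmod c < 1"
    and "p \<noteq> 0" "peval G p v = 0"
  shows "(\<lambda>k. (((*v) G) ^^ k) v) \<longlonglongrightarrow> 0"
  using assms(2,3)
proof (induction "degree p" arbitrary: p v)
  case 0
  then obtain a where "p = [:a:]" "a \<noteq> 0" by (metis degree_eq_zeroE pCons_0_0)
  with 0 have "v = 0" by (simp add: vector_mul_eq_0)
  have "(((*v) G) ^^ k) 0 = 0" for k by (induction k) simp_all
  then show ?case using \<open>v = 0\<close> by simp
next
  case (Suc d)
  have "\<not> constant (poly p)" using Suc(2) by (simp add: constant_degree)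
  then obtain l where "poly p l = 0" using fundamental_theorem_of_algebra by blast
  then obtain q where q: "p = [:- l, 1:] * q" by (metis dvd_def poly_eq_0_iff_dvd)
  then have "q \<noteq> 0" using Suc(3) by auto
  then have deg: "d = degree q"
    using Suc(2) degree_mult_eq[of "[:- l, 1:]" q] unfolding q by simp
  have fac: "G *v peval G q v - l *s peval G q v = 0"
  proof -
    have "p = smult (- l) q + pCons 0 q" by (simp add: q)
    then have "peval G p v = (- l) *s peval G q v + G *v peval G q v"
      by (simp only: peval_add peval_smult peval_pCons) simp
    then show ?thesis using Suc(4) by simp
  qed
  show ?case
  proof (cases "peval G q v = 0")
    case True
    then show ?thesis using Suc(1)[OF deg \<open>q \<noteq> 0\<close>] by blast
  next
    case False
    then have l: "cmod l < 1" using stable fac by simp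
    define w where "w = G *v v + (- l) *s v"
    have "peval G q w = G *v peval G q v + (- l) *s peval G q v"
      unfolding w_def peval_vec_add peval_vec_scale peval_commute ..
    then have "peval G q w = 0" using fac by simp
    then have lim: "(\<lambda>k. (((*v) G) ^^ k) w) \<longlonglongrightarrow> 0" by (rule Suc(1)[OF deg \<open>q \<noteq> 0\<close>])
    have rec: "(((*v) G) ^^ Suc k) v = l *s (((*v) G) ^^ k) v + (((*v) G) ^^ k) w" for k
    proof (induction k)
      case (Suc k)
      have "(((*v) G) ^^ Suc (Suc k)) v = G *v ((((*v) G) ^^ Suc k) v)" by simp
      also have "\<dots> = G *v (l *s (((*v) G) ^^ k) v + (((*v) G) ^^ k) w)" by (simp only: Suc)
      finally show ?case by (simp add: vec.add vec.scale)
    qed (simp add: w_def vec_eq_iff)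
    have ns: "norm (l *s x) = cmod l * norm x" for x :: "complex^'n"
      by (simp add: norm_vec_def L2_set_def norm_mult power_mult_distrib sum_distrib_left[symmetric]
          real_sqrt_mult)
    have "(\<lambda>k. norm ((((*v) G) ^^ k) v)) \<longlonglongrightarrow> 0"
    proof (rule contracting_recursion_tendsto_0[OF norm_ge_zero l norm_ge_zero])
      show "norm ((((*v) G) ^^ Suc k) v) \<le> cmod l * norm ((((*v) G) ^^ k) v) + norm ((((*v) G) ^^ k) w)" for k
        unfolding rec ns[symmetric] by (rule norm_triangle_ineq)
      show "(\<lambda>k. norm ((((*v) G) ^^ k) w)) \<longlonglongrightarrow> 0" using lim by (rule tendsto_norm_zero)
    qed
    then show ?thesis by (rule tendsto_norm_zero_cancel)
  qed
qed

text \<open>Complexification \<open>cv\<close> intertwines \<open>F\<close> with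
  \<open>cmat F\<close> and preserves the norm, so the claim can be proved over the complex numbers,
  where polynomials have roots.\<close>

lemma schur_stable_powers_tendsto_0:
  fixes F :: "real^'n^'n"
  assumes "schur_stable F"
  shows "(\<lambda>k. (((*v) F) ^^ k) x) \<longlonglongrightarrow> 0"
proof -
  define cv :: "real^'n \<Rightarrow> complex^'n" where "cv x = (\<chi> i. complex_of_real (x $ i))" for x
  have cv: "cv (((*v) F ^^ k) x) = ((*v) (cmat F) ^^ k) (cv x)" for k
  proof (induction k)
    case (Suc k)
    have "cv (F *v y) = cmat F *v cv y" for y
      by (simp add: cv_def cmat_def matrix_vector_mult_def vec_eq_iff)
    then show ?case by (simp add: Suc[symmetric])
  qed simp
  have eig: "cmod c < 1" if "cmat F *v w = c *s w" "w \<noteq> 0" for c w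
  proof -
    have "mat c *v w = c *s w"
      by (simp add: mat_def matrix_vector_mult_def vec_eq_iff if_distrib[where f = "\<lambda>x. x * _"] cong: if_cong)
    then have "(mat c - cmat F) *v w = 0" using that(1) by (simp add: matrix_vector_mult_diff_rdistrib)
    then have "\<not> invertible (mat c - cmat F)" using that(2)
      by (auto simp: invertible_left_inverse matrix_left_invertible_ker)
    then have "det (mat c - cmat F) = 0" by (simp add: invertible_det_nz)
    then show ?thesis using assms by (simp add: schur_stable_def)
  qed
  obtain p where "p \<noteq> 0" "peval (cmat F) p (cv x) = 0" by (rule annihilating_poly)
  then have "(\<lambda>k. ((*v) (cmat F) ^^ k) (cv x)) \<longlonglongrightarrow> 0"
    using powers_tendsto_0_aux[of "cmat F" p "cv x"] eig by blast
  then have "(\<lambda>k. norm (cv (((*v) F ^^ k) x))) \<longlonglongrightarrow> 0" by (simp add: cv tendsto_norm_zero)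
  moreover have "norm (cv y) = norm y" for y
    by (simp add: cv_def norm_vec_def)
  ultimately show ?thesis by (simp add: tendsto_norm_zero_iff)
qed

text \<open>Some power \<open>m\<close> of \<open>F\<close> at least halves every norm, so the sum
  of the norms of the first \<open>m\<close> iterates is an adapted norm: applying \<open>F\<close>
  trades \<open>norm x\<close> for at most half of it. The triangle inequality survives, which later
  admits perturbations.\<close>

lemma schur_stable_contraction_norm:
  fixes F :: "real^'n^'n"
  assumes "schur_stable F"
  obtains U :: "real^'n \<Rightarrow> real" and \<rho> K where "continuous_on UNIV U" "0 \<le> \<rho>" "\<rho> < 1" "0 \<le> K"
    "\<And>x. norm x \<le> U x" "\<And>x. U x \<le> K * norm x"
    "\<And>x. U (F *v x) \<le> \<rho> * U x" "\<And>x y. U (x + y) \<le> U x + U y"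
proof -
  define Fk where "Fk k = ((*v) F) ^^ k" for k
  have lin: "linear (Fk k)" for k
    by (induction k) (auto simp: Fk_def id_def linear_compose[unfolded o_def] linear_id[unfolded id_def] comp_def)
  have "(\<lambda>k. \<Sum>b\<in>Basis. norm (Fk k b)) \<longlonglongrightarrow> (\<Sum>b\<in>(Basis::(real^'n) set). 0)"
    using schur_stable_powers_tendsto_0[OF assms]
    by (intro tendsto_sum tendsto_norm_zero) (simp add: Fk_def)
  then have "(\<lambda>k. \<Sum>b\<in>Basis. norm (Fk k b)) \<longlonglongrightarrow> 0" by simp
  then have "\<forall>\<^sub>F k in sequentially. (\<Sum>b\<in>Basis. norm (Fk k b)) < 1 / 2"
    by (rule order_tendstoD) simp
  then obtain m where m: "(\<Sum>b\<in>Basis. norm (Fk m b)) < 1 / 2"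
    by (auto simp: eventually_sequentially)
  have half: "norm (Fk m x) \<le> norm x / 2" for x
  proof -
    have "norm (Fk m x) = norm (\<Sum>b\<in>Basis. (x \<bullet> b) *\<^sub>R Fk m b)"
      using linear_sum[OF lin[of m], of "\<lambda>b. (x \<bullet> b) *\<^sub>R b" Basis]
      by (simp add: euclidean_representation linear_scale[OF lin])
    also have "\<dots> \<le> (\<Sum>b\<in>Basis. \<bar>x \<bullet> b\<bar> * norm (Fk m b))"
      by (rule order_trans[OF norm_sum]) simp
    also have "\<dots> \<le> (\<Sum>b\<in>Basis. norm x * norm (Fk m b))"
      by (intro sum_mono mult_right_mono Basis_le_norm) auto
    also have "\<dots> = norm x * (\<Sum>b\<in>Basis. norm (Fk m b))" by (simp add: sum_distrib_left)
    also have "\<dots> \<le> norm x * (1 / 2)" using m by (intro mult_left_mono) auto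
    finally show ?thesis by simp
  qed
  \<comment> \<open>With m = 0 the power would be the identity, which halves no basis vector; m > 0
    puts the term \<open>norm x\<close> into the sum \<open>U x\<close>.\<close>
  have "m > 0"
  proof (rule ccontr)
    assume "\<not> m > 0"
    obtain b :: "real^'n" where "b \<in> Basis" using nonempty_Basis by blast
    with half[of b] \<open>\<not> m > 0\<close> show False by (simp add: Fk_def)
  qed
  define U where "U x = (\<Sum>k<m. norm (Fk k x))" for x
  have cont: "continuous_on UNIV U" unfolding U_def
    by (intro continuous_intros linear_continuous_on) (simp add: lin linear_conv_bounded_linear[symmetric])
  have lower: "norm x \<le> U x" for x
  proof -
    have "norm (Fk 0 x) \<le> U x" unfolding U_def by (rule member_le_sum) (use \<open>m > 0\<close> in auto)
    then show ?thesis by (simp add: Fk_def)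
  qed
  have "\<forall>k. \<exists>B. \<forall>x. norm (Fk k x) \<le> B * norm x" using linear_bounded[OF lin] by blast
  then obtain Bd where Bd: "\<And>k x. norm (Fk k x) \<le> Bd k * norm x" by metis
  \<comment> \<open>The form ensures \<open>K \<ge> 1\<close>, so that the rate
    \<open>1 - 1 / (2 * K)\<close> lies between 0 and 1.\<close>
  define K where "K = \<bar>\<Sum>k<m. Bd k\<bar> + 1"
  have upper: "U x \<le> K * norm x" for x
  proof -
    have "U x \<le> (\<Sum>k<m. Bd k * norm x)" unfolding U_def by (intro sum_mono Bd)
    also have "\<dots> = (\<Sum>k<m. Bd k) * norm x" by (simp add: sum_distrib_right)
    also have "\<dots> \<le> K * norm x" by (intro mult_right_mono) (auto simp: K_def)
    finally show ?thesis .
  qed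
  have "K \<ge> 1" by (simp add: K_def)
  have dec: "U (F *v x) \<le> (1 - 1 / (2 * K)) * U x" for x
  proof -
    have "Fk k (F *v x) = Fk (Suc k) x" for k by (simp add: Fk_def funpow_swap1)
    then have "U (F *v x) = (\<Sum>k<m. norm (Fk (Suc k) x))" by (simp add: U_def)
    also have "\<dots> = U x + norm (Fk m x) - norm x"
      using sum.lessThan_Suc_shift[of "\<lambda>k. norm (Fk k x)" m] by (simp add: U_def Fk_def)
    also have "\<dots> \<le> U x - norm x / 2" using half[of x] by simp
    also have "\<dots> \<le> U x - U x / (2 * K)" using upper[of x] \<open>K \<ge> 1\<close> by (simp add: field_simps)
    finally show ?thesis by (simp add: algebra_simps)
  qed
  have tri: "U (x + y) \<le> U x + U y" for x y
    unfolding U_def sum.distrib[symmetric] linear_add[OF lin] by (intro sum_mono norm_triangle_ineq)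
  show ?thesis
    by (rule that[OF cont _ _ _ lower upper dec tri]) (use \<open>K \<ge> 1\<close> in \<open>auto simp: field_simps\<close>)
qed

text \<open>\<open>S\<close> is a state energy that decays except for what stage cost and
  disturbance supply. Actions and disturbances are arbitrary, so the inequality applies pathwise to
  every strategy.\<close>

definition dissipative where
  "dissipative A B Q R S \<rho> K \<longleftrightarrow> continuous_on UNIV S \<and> 0 \<le> \<rho> \<and> \<rho> < 1 \<and> 0 \<le> K \<and>
    (\<forall>x. (norm x)\<^sup>2 \<le> S x \<and> S x \<le> K * (norm x)\<^sup>2) \<and>
    (\<forall>x u w. S (A *v x + B *v u + w) \<le> \<rho> * S x + K * (qf Q x + qf R u + (norm w)\<^sup>2))"

text \<open>Lets the deviations and the deep state share one rate and one constant.\<close>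

lemma dissipative_mono:
  assumes "dissipative A B Q R S \<rho> K" "psd Q" "psd R" "\<rho> \<le> \<rho>'" "\<rho>' < 1" "K \<le> K'"
  shows "dissipative A B Q R S \<rho>' K'"
proof -
  have S: "0 \<le> S x" for x using assms(1) by (auto simp: dissipative_def intro: order_trans[OF zero_le_power2])
  have "S (A *v x + B *v u + w) \<le> \<rho>' * S x + K' * (qf Q x + qf R u + (norm w)\<^sup>2)" for x u w
  proof -
    have "S (A *v x + B *v u + w) \<le> \<rho> * S x + K * (qf Q x + qf R u + (norm w)\<^sup>2)"
      using assms(1) by (auto simp: dissipative_def)
    also have "\<dots> \<le> \<rho>' * S x + K' * (qf Q x + qf R u + (norm w)\<^sup>2)"
      using assms S by (intro add_mono mult_right_mono) (auto simp: psd_def)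
    finally show ?thesis .
  qed
  moreover have "S x \<le> K' * (norm x)\<^sup>2" for x
    using assms(1,6) by (auto simp: dissipative_def intro: order_trans[OF _ mult_right_mono])
  ultimately show ?thesis using assms by (auto simp: dissipative_def)
qed

lemma three_squares: "(a + b + c)\<^sup>2 \<le> 3 * (a\<^sup>2 + b\<^sup>2 + (c::real)\<^sup>2)"
proof -
  have "0 \<le> (a - b)\<^sup>2 + (b - c)\<^sup>2 + (a - c)\<^sup>2" by simp
  then show ?thesis by (simp add: power2_eq_square algebra_simps)
qed

text \<open>Output injection: \<open>L *v (C *v x)\<close> is added to the dynamics, which then
  contract in \<open>U\<close>, and subtracted again as part of an error \<open>e\<close>. The error
  is paid for by state cost, control cost and disturbance.\<close>

lemma detectable_dissipative:
  fixes A :: "real^'n^'n" and B :: "real^'m^'n"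
  assumes "symm Q" "psd Q" "pd R" "detectable A (msqrt Q)"
  obtains S \<rho> K where "dissipative A B Q R S \<rho> K"
proof -
  define C where "C = msqrt Q"
  obtain L where "schur_stable (A + L ** C)" using assms(4) by (auto simp: detectable_def C_def)
  from schur_stable_contraction_norm[OF this] obtain U \<rho> K
    where U: "continuous_on UNIV U" "0 \<le> \<rho>" "\<rho> < 1" "0 \<le> K" "\<And>x. norm x \<le> U x" "\<And>x. U x \<le> K * norm x"
      "\<And>x. U ((A + L ** C) *v x) \<le> \<rho> * U x" "\<And>x y. U (x + y) \<le> U x + U y"
    by metis
  obtain KR where KR: "KR \<ge> 0" "\<And>u. (norm u)\<^sup>2 \<le> KR * qf R u" using pd_lower_bound[OF assms(3)] by blast
  obtain KB where KB: "KB \<ge> 0" "\<And>u. norm (B *v u) \<le> KB * norm u" using norm_mult_vec_le by blast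
  obtain KL where KL: "KL \<ge> 0" "\<And>u. norm (L *v u) \<le> KL * norm u" using norm_mult_vec_le by blast
  define k where "k = K\<^sup>2 / (1 - \<rho>)"
  have "k \<ge> 0" using U by (simp add: k_def)
  define K1 where "K1 = k * 3 * (KL\<^sup>2 + KB\<^sup>2 * KR + 1)"
  have "K1 \<ge> 0" using \<open>k \<ge> 0\<close> KR by (simp add: K1_def)
  define S where "S x = (U x)\<^sup>2" for x
  have U0: "0 \<le> U x" for x using U(5)[of x] norm_ge_zero[of x] by linarith
  have "(norm x)\<^sup>2 \<le> S x" "S x \<le> (K1 + K\<^sup>2) * (norm x)\<^sup>2" for x
  proof -
    show "(norm x)\<^sup>2 \<le> S x" unfolding S_def by (intro power_mono U) auto
    have "S x \<le> (K * norm x)\<^sup>2" unfolding S_def by (intro power_mono U U0)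
    also have "\<dots> \<le> (K1 + K\<^sup>2) * (norm x)\<^sup>2" using \<open>K1 \<ge> 0\<close> by (simp add: power_mult_distrib algebra_simps)
    finally show "S x \<le> (K1 + K\<^sup>2) * (norm x)\<^sup>2" .
  qed
  moreover have "S (A *v x + B *v u + w) \<le> \<rho> * S x + (K1 + K\<^sup>2) * (qf Q x + qf R u + (norm w)\<^sup>2)" for x u w
  proof -
    define e where "e = B *v u - L *v (C *v x) + w"
    have "A *v x + B *v u + w = (A + L ** C) *v x + e"
      by (simp add: e_def matrix_vector_mult_add_rdistrib matrix_vector_mul_assoc)
    then have "U (A *v x + B *v u + w) \<le> \<rho> * U x + K * norm e"
      using U(8)[of "(A + L ** C) *v x" e] U(7)[of x] U(6)[of e] by simp
    then have "S (A *v x + B *v u + w) \<le> (\<rho> * U x + K * norm e)\<^sup>2"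
      unfolding S_def by (intro power_mono U0)
    \<comment> \<open>Convexity of the square with weights \<open>\<rho>\<close> and
      \<open>1 - \<rho>\<close>; the usual bound with factor 2 could destroy the
      contraction.\<close>
    also have "\<dots> \<le> \<rho> * (U x)\<^sup>2 + (K * norm e)\<^sup>2 / (1 - \<rho>)"
    proof -
      have "0 \<le> \<rho> * ((1 - \<rho>) * U x - K * norm e)\<^sup>2" using U by simp
      then have "(\<rho> * U x + K * norm e)\<^sup>2 * (1 - \<rho>) \<le> (\<rho> * (U x)\<^sup>2) * (1 - \<rho>) + (K * norm e)\<^sup>2"
        by (simp add: power2_eq_square algebra_simps)
      then show ?thesis using U(3) by (simp add: field_simps)
    qed
    also have "\<dots> = \<rho> * S x + k * (norm e)\<^sup>2" by (simp add: S_def k_def power_mult_distrib)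
    also have "(norm e)\<^sup>2 \<le> 3 * ((KL\<^sup>2 + KB\<^sup>2 * KR + 1) * (qf Q x + qf R u + (norm w)\<^sup>2))"
    proof -
      have q: "0 \<le> qf Q x" "0 \<le> qf R u" using assms pd_imp_psd by (auto simp: psd_def)
      have "norm e \<le> KB * norm u + KL * norm (C *v x) + norm w"
        unfolding e_def using KB(2)[of u] KL(2)[of "C *v x"]
        by (smt (verit) norm_triangle_ineq norm_triangle_ineq4)
      then have "(norm e)\<^sup>2 \<le> (KB * norm u + KL * norm (C *v x) + norm w)\<^sup>2" by (intro power_mono) auto
      also have "\<dots> \<le> 3 * ((KB * norm u)\<^sup>2 + (KL * norm (C *v x))\<^sup>2 + (norm w)\<^sup>2)"
        by (rule three_squares)
      also have "(KB * norm u)\<^sup>2 \<le> KB\<^sup>2 * KR * qf R u"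
        using KR(2)[of u] by (simp add: power_mult_distrib mult_left_mono mult.assoc)
      also have "(KL * norm (C *v x))\<^sup>2 = KL\<^sup>2 * qf Q x"
        using norm_msqrt_mult[OF assms(1,2)] by (simp add: power_mult_distrib C_def)
      also have "3 * (KB\<^sup>2 * KR * qf R u + KL\<^sup>2 * qf Q x + (norm w)\<^sup>2) \<le>
          3 * ((KL\<^sup>2 + KB\<^sup>2 * KR + 1) * (qf Q x + qf R u + (norm w)\<^sup>2))"
        using q KR(1) by (simp add: algebra_simps)
      finally show ?thesis by simp
    qed
    then have "k * (norm e)\<^sup>2 \<le> k * (3 * ((KL\<^sup>2 + KB\<^sup>2 * KR + 1) * (qf Q x + qf R u + (norm w)\<^sup>2)))"
      using \<open>k \<ge> 0\<close> by (rule mult_left_mono)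
    then have "\<rho> * S x + k * (norm e)\<^sup>2 \<le> \<rho> * S x + K1 * (qf Q x + qf R u + (norm w)\<^sup>2)"
      unfolding K1_def by (simp only: mult.assoc add_le_cancel_left)
    also have "\<dots> \<le> \<rho> * S x + (K1 + K\<^sup>2) * (qf Q x + qf R u + (norm w)\<^sup>2)"
      using assms(2) pd_imp_psd[OF assms(3)] by (intro add_left_mono mult_right_mono) (auto simp: psd_def)
    finally show ?thesis .
  qed
  moreover have "continuous_on UNIV S" unfolding S_def by (intro continuous_intros U)
  ultimately have "dissipative A B Q R S \<rho> (K1 + K\<^sup>2)"
    using U(2,3) \<open>K1 \<ge> 0\<close> by (auto simp: dissipative_def)
  then show ?thesis by (rule that)
qed

section \<open>Block structure and the deviations from the deep state\<close>

text \<open>For orthonormal factors this is the residual of the orthogonal projection of the joint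
  state onto the span of the columns of \<alpha>.\<close>

definition dev :: "('n::finite \<Rightarrow> 'z::finite \<Rightarrow> real) \<Rightarrow> ('n \<Rightarrow> real^'h) \<Rightarrow> 'n \<Rightarrow> real^'h::finite" where
  "dev \<alpha> x i = x i - (\<Sum>j\<in>UNIV. \<alpha> i j *\<^sub>R blk (deep \<alpha> x) j)"

lemma blk_add: "blk (v + w) j = blk v j + blk w j"
  by (simp add: blk_def vec_eq_iff)

lemma blk_eqI: "(\<And>j. blk v j = blk w j) \<Longrightarrow> v = w"
  by (simp add: blk_def vec_eq_iff)

lemma blk_deep: "blk (deep \<alpha> x) j = (1 / real CARD('n)) *\<^sub>R (\<Sum>i\<in>UNIV. \<alpha> i j *\<^sub>R x i)"
  for x :: "'n::finite \<Rightarrow> real^'h::finite"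
  by (simp add: blk_def deep_def vec_eq_iff)

lemma inner_blk: "v \<bullet> w = (\<Sum>j\<in>UNIV. blk v j \<bullet> blk w j)"
  unfolding inner_vec_def blk_def sum.cartesian_product UNIV_Times_UNIV by (auto intro!: sum.cong)

lemma blk_bdiagf: "blk (bdiagf M *v v) j = M j *v blk v j"
proof -
  have "(bdiagf M *v v) $ (j, a) = (\<Sum>k\<in>UNIV. \<Sum>b\<in>UNIV. if j = k then M j $ a $ b * v $ (k, b) else 0)" for a
    unfolding matrix_vector_mult_def bdiagf_def
    unfolding sum.cartesian_product UNIV_Times_UNIV by (auto intro!: sum.cong)
  also have "\<dots> a = (\<Sum>b\<in>UNIV. M j $ a $ b * v $ (j, b))" for a
    by (subst sum.swap) simp
  finally show ?thesis by (simp add: blk_def vec_eq_iff matrix_vector_mult_def)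
qed

lemma blk_stack: "blk (stack N *v v) j = N j *v v"
  by (simp add: blk_def stack_def matrix_vector_mult_def vec_eq_iff)

lemma blk_bold: "blk (bold M N *v v) j = M *v blk v j + N j *v v"
  by (simp add: bold_def bdiag_def matrix_vector_mult_add_rdistrib blk_add blk_bdiagf blk_stack)

lemma qf_bdiagf: "qf (bdiagf M) v = (\<Sum>j\<in>UNIV. qf (M j) (blk v j))"
  by (simp add: qf_def inner_blk blk_bdiagf)

lemma symm_add: "symm M \<Longrightarrow> symm N \<Longrightarrow> symm (M + N)"
  by (simp add: symm_def transpose_def vec_eq_iff)

lemma qf_add_matrix: "qf (M + N) v = qf M v + qf N v"
  by (simp add: qf_def matrix_vector_mult_add_rdistrib inner_add_right)

lemma symm_bdiagf: "(\<And>j. symm (M j)) \<Longrightarrow> symm (bdiagf M)"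
  by (auto simp: symm_def bdiagf_def transpose_def vec_eq_iff)

text \<open>Extend a vector by zero to the other blocks. Definiteness is assumed of the whole block
  matrix, whereas the Bellman relation is derived block by block.\<close>

lemma pd_bdiagf_block:
  fixes M :: "'z::finite \<Rightarrow> real^'h^'h"
  assumes "pd (bdiagf M)" shows "pd (M j)"
  unfolding pd_def
proof (intro allI impI)
  fix x :: "real^'h" assume "x \<noteq> 0"
  define v where "v = (\<chi> p. if fst p = j then x $ snd p else 0)"
  have v: "blk v k = (if k = j then x else 0)" for k by (simp add: v_def blk_def vec_eq_iff)
  then have "v \<noteq> 0" using \<open>x \<noteq> 0\<close> by (auto simp: blk_def vec_eq_iff)
  then have "0 < qf (bdiagf M) v" using assms by (simp add: pd_def)
  also have "\<dots> = (\<Sum>k\<in>UNIV. if k = j then qf (M j) x else 0)"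
    unfolding qf_bdiagf by (intro sum.cong) (auto simp: v qf_def)
  finally show "0 < qf (M j) x" by simp
qed

lemma matrix_vector_mult_sum: "A *v (\<Sum>i\<in>S. f i) = (\<Sum>i\<in>S. A *v (f i :: real^'n))"
  by (rule linear_sum) simp

text \<open>The weakly coupled deep state splits into one control problem per factor; their summed
  Bellman relations stand in for a Riccati equation with block-diagonal matrices.\<close>

lemma bellman_bdiagf:
  assumes "\<And>j. bellman \<beta> (A j) (B j) (Q j) (R j) (P j) (\<theta> j)"
  shows "bellman \<beta> (bdiagf A) (bdiagf B) (bdiagf Q) (bdiagf R) (bdiagf P) (bdiagf \<theta>)"
proof -
  have "(\<Sum>j\<in>UNIV. qf (P j) (blk x j)) \<le> (\<Sum>j\<in>UNIV. qf (Q j) (blk x j) + qf (R j) (blk u j)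
        + \<beta> * qf (P j) (A j *v blk x j + B j *v blk u j))" for x u
    using assms unfolding bellman_def by (intro sum_mono) blast
  moreover have "(\<Sum>j\<in>UNIV. qf (P j) (blk x j)) = (\<Sum>j\<in>UNIV. qf (Q j) (blk x j) + qf (R j) (\<theta> j *v blk x j)
        + \<beta> * qf (P j) (A j *v blk x j + B j *v (\<theta> j *v blk x j)))" for x
    using assms unfolding bellman_def by (intro sum.cong) blast+
  ultimately show ?thesis
    unfolding bellman_def qf_bdiagf blk_add blk_bdiagf by (simp add: sum.distrib sum_distrib_left)
qed

section \<open>Orthonormal factors: decoupling of dynamics and cost\<close>

definition orthonormal_factors :: "('n::finite \<Rightarrow> 'z::finite \<Rightarrow> real) \<Rightarrow> bool" where
  "orthonormal_factors \<alpha> \<longleftrightarrow>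
     (\<forall>j k. (\<Sum>i\<in>UNIV. \<alpha> i j * \<alpha> i k) / real CARD('n) = (if j = k then 1 else 0))"

lemma factor_sum:
  fixes \<alpha> :: "'n::finite \<Rightarrow> 'z::finite \<Rightarrow> real"
  assumes "orthonormal_factors \<alpha>"
  shows "(\<Sum>i\<in>UNIV. \<alpha> i j * \<alpha> i k) = (if j = k then real CARD('n) else 0)"
  using assms[unfolded orthonormal_factors_def, rule_format, of j k]
  by (auto simp: field_simps split: if_splits)

text \<open>Orthonormality makes averaging against the factors a left inverse of synthesis from
  them. Every later use of orthonormality goes through this fact.\<close>

lemma blk_deep_synth:
  fixes \<alpha> :: "'n::finite \<Rightarrow> 'z::finite \<Rightarrow> real" and v :: "'z \<Rightarrow> real^'h::finite"
  assumes "orthonormal_factors \<alpha>"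
  shows "blk (deep \<alpha> (\<lambda>i. \<Sum>j\<in>UNIV. \<alpha> i j *\<^sub>R v j)) k = v k"
proof -
  have "(\<Sum>i\<in>UNIV. \<alpha> i k *\<^sub>R (\<Sum>j\<in>UNIV. \<alpha> i j *\<^sub>R v j)) = (\<Sum>j\<in>UNIV. (\<Sum>i\<in>UNIV. \<alpha> i k * \<alpha> i j) *\<^sub>R v j)"
    by (simp add: scaleR_sum_right scaleR_sum_left) (rule sum.swap)
  also have "\<dots> = (\<Sum>j\<in>UNIV. if k = j then real CARD('n) *\<^sub>R v j else 0)"
    by (intro sum.cong) (auto simp: factor_sum[OF assms])
  finally show ?thesis by (simp add: blk_deep)
qed

lemma deep_add: "deep \<alpha> (\<lambda>i. x i + y i) = deep \<alpha> x + deep \<alpha> y"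
  by (rule blk_eqI) (simp add: blk_add blk_deep scaleR_add_right sum.distrib)

lemma blk_deep_mult: "blk (deep \<alpha> (\<lambda>i. A *v x i)) j = A *v blk (deep \<alpha> x) j"
  by (simp add: blk_deep matrix_vector_mult_sum matrix_vector_mult_scaleR)

lemma blk_deep_dev:
  assumes "orthonormal_factors \<alpha>" shows "blk (deep \<alpha> (dev \<alpha> x)) j = 0"
proof -
  have "x i = dev \<alpha> x i + (\<Sum>j\<in>UNIV. \<alpha> i j *\<^sub>R blk (deep \<alpha> x) j)" for i
    by (simp add: dev_def)
  then have "deep \<alpha> x = deep \<alpha> (\<lambda>i. dev \<alpha> x i + (\<Sum>j\<in>UNIV. \<alpha> i j *\<^sub>R blk (deep \<alpha> x) j))"
    by (intro arg_cong[of _ _ "deep \<alpha>"] ext)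
  then have "blk (deep \<alpha> x) j = blk (deep \<alpha> (dev \<alpha> x)) j
      + blk (deep \<alpha> (\<lambda>i. \<Sum>j\<in>UNIV. \<alpha> i j *\<^sub>R blk (deep \<alpha> x) j)) j"
    unfolding deep_add blk_add[symmetric] by (rule arg_cong)
  then show ?thesis unfolding blk_deep_synth[OF assms] by simp
qed

lemma deep_decoupling:
  fixes \<alpha> :: "'n::finite \<Rightarrow> 'z::finite \<Rightarrow> real" and w :: "'n \<Rightarrow> real^'h::finite"
  assumes "orthonormal_factors \<alpha>"
    and F: "\<And>j. A *v blk (deep \<alpha> x) j + B *v blk (deep \<alpha> u) j + cpl j = blk F j"
  shows "deep \<alpha> (\<lambda>i. A *v x i + B *v u i + (\<Sum>j\<in>UNIV. \<alpha> i j *\<^sub>R cpl j) + w i) = F + deep \<alpha> w"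
  by (rule blk_eqI)
     (simp add: deep_add blk_add blk_deep_mult blk_deep_synth[OF assms(1)] F[symmetric])

text \<open>The coupling enters every agent as a combination of the factors, so the projection
  removes it.\<close>

lemma dev_decoupling:
  fixes \<alpha> :: "'n::finite \<Rightarrow> 'z::finite \<Rightarrow> real" and w :: "'n \<Rightarrow> real^'h::finite"
  assumes "orthonormal_factors \<alpha>"
  shows "dev \<alpha> (\<lambda>i. A *v x i + B *v u i + (\<Sum>j\<in>UNIV. \<alpha> i j *\<^sub>R cpl j) + w i) i
    = A *v dev \<alpha> x i + B *v dev \<alpha> u i + dev \<alpha> w i"
  by (simp add: dev_def deep_add blk_add blk_deep_mult blk_deep_synth[OF assms(1)] matrix_vector_mult_sum
      matrix_vector_mult_scaleR matrix_vector_mult_diff_distrib scaleR_add_right sum.distrib)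

text \<open>Pythagoras for the splitting into deviation and synthesized deep state: the cross terms
  vanish because deviations have zero deep state.\<close>

lemma sum_qf_decoupling:
  fixes \<alpha> :: "'n::finite \<Rightarrow> 'z::finite \<Rightarrow> real" and x :: "'n \<Rightarrow> real^'h::finite"
  assumes "orthonormal_factors \<alpha>"
  shows "(\<Sum>i\<in>UNIV. qf Q (x i)) / real CARD('n)
    = (\<Sum>i\<in>UNIV. qf Q (dev \<alpha> x i)) / real CARD('n) + (\<Sum>j\<in>UNIV. qf Q (blk (deep \<alpha> x) j))"
proof -
  define d where "d j = blk (deep \<alpha> x) j" for j
  define m where "m i = (\<Sum>j\<in>UNIV. \<alpha> i j *\<^sub>R d j)" for i
  define y where "y = dev \<alpha> x"
  have n: "real CARD('n) \<noteq> 0" by simp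
  have y0: "(\<Sum>i\<in>UNIV. \<alpha> i j *\<^sub>R y i) = 0" for j
    using blk_deep_dev[OF assms, of x j] by (simp add: blk_deep y_def)
  have msum: "(\<Sum>i\<in>UNIV. \<alpha> i j *\<^sub>R m i) = real CARD('n) *\<^sub>R d j" for j
  proof -
    have "(1 / real CARD('n)) *\<^sub>R (\<Sum>i\<in>UNIV. \<alpha> i j *\<^sub>R m i) = d j"
      using blk_deep_synth[OF assms, of d j] by (simp add: blk_deep m_def)
    from arg_cong[OF this, of "\<lambda>v. real CARD('n) *\<^sub>R v"] show ?thesis by simp
  qed
  \<comment> \<open>A general \<open>f\<close> serves both a cross term and the square of
    \<open>m\<close>; the other cross term has \<open>m\<close> on the left of \<open>Q\<close> and
    is treated next.\<close>
  have qm: "(\<Sum>i\<in>UNIV. f i \<bullet> (Q *v m i)) = (\<Sum>j\<in>UNIV. (\<Sum>i\<in>UNIV. \<alpha> i j *\<^sub>R f i) \<bullet> (Q *v d j))" for f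
  proof -
    have "(\<Sum>i\<in>UNIV. f i \<bullet> (Q *v m i)) = (\<Sum>i\<in>UNIV. \<Sum>j\<in>UNIV. \<alpha> i j * (f i \<bullet> (Q *v d j)))"
      by (simp add: m_def matrix_vector_mult_sum inner_sum_right matrix_vector_mult_scaleR)
    also have "\<dots> = (\<Sum>j\<in>UNIV. \<Sum>i\<in>UNIV. \<alpha> i j * (f i \<bullet> (Q *v d j)))" by (rule sum.swap)
    finally show ?thesis by (simp add: inner_sum_left)
  qed
  have mq: "(\<Sum>i\<in>UNIV. m i \<bullet> (Q *v y i)) = (\<Sum>j\<in>UNIV. d j \<bullet> (Q *v (\<Sum>i\<in>UNIV. \<alpha> i j *\<^sub>R y i)))"
  proof -
    have "(\<Sum>i\<in>UNIV. m i \<bullet> (Q *v y i)) = (\<Sum>i\<in>UNIV. \<Sum>j\<in>UNIV. \<alpha> i j * (d j \<bullet> (Q *v y i)))"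
      by (simp add: m_def inner_sum_left)
    also have "\<dots> = (\<Sum>j\<in>UNIV. \<Sum>i\<in>UNIV. \<alpha> i j * (d j \<bullet> (Q *v y i)))" by (rule sum.swap)
    finally show ?thesis by (simp add: matrix_vector_mult_sum inner_sum_right matrix_vector_mult_scaleR)
  qed
  have "x i = y i + m i" for i by (simp add: y_def m_def d_def dev_def)
  then have "(\<Sum>i\<in>UNIV. qf Q (x i)) = (\<Sum>i\<in>UNIV. qf Q (y i)) + (\<Sum>i\<in>UNIV. y i \<bullet> (Q *v m i))
      + (\<Sum>i\<in>UNIV. m i \<bullet> (Q *v y i)) + (\<Sum>i\<in>UNIV. m i \<bullet> (Q *v m i))"
    by (simp add: qf_add sum.distrib) (simp add: qf_def)
  also have "\<dots> = (\<Sum>i\<in>UNIV. qf Q (y i)) + real CARD('n) * (\<Sum>j\<in>UNIV. qf Q (d j))"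
    unfolding qm mq y0 msum by (simp add: qf_def sum_distrib_left)
  finally show ?thesis using n by (simp add: y_def d_def field_simps)
qed

text \<open>Subtracting \<open>\<theta>\<close> on the deep part leaves \<open>\<theta>\<close>
  acting on the deviation only, so in the split coordinates the proposed strategy is pure
  feedback.\<close>

lemma dev_control:
  fixes \<alpha> :: "'n::finite \<Rightarrow> 'z::finite \<Rightarrow> real"
  assumes "orthonormal_factors \<alpha>"
    and u: "\<And>i. u i = \<theta> *v x i + (\<Sum>j\<in>UNIV. \<alpha> i j *\<^sub>R (blk (\<theta>b *v deep \<alpha> x) j - \<theta> *v blk (deep \<alpha> x) j))"
  shows "deep \<alpha> u = \<theta>b *v deep \<alpha> x" "dev \<alpha> u i = \<theta> *v dev \<alpha> x i"
proof -
  have u': "u = (\<lambda>i. \<theta> *v dev \<alpha> x i + (\<Sum>j\<in>UNIV. \<alpha> i j *\<^sub>R blk (\<theta>b *v deep \<alpha> x) j))"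
    by (auto simp: u dev_def scaleR_diff_right sum_subtractf matrix_vector_mult_diff_distrib
        matrix_vector_mult_sum matrix_vector_mult_scaleR)
  show d: "deep \<alpha> u = \<theta>b *v deep \<alpha> x"
    unfolding u' by (rule blk_eqI)
      (simp add: deep_add blk_add blk_deep_mult blk_deep_dev[OF assms(1)] blk_deep_synth[OF assms(1)])
  show "dev \<alpha> u i = \<theta> *v dev \<alpha> x i" unfolding dev_def[of _ u] d by (simp add: u')
qed

text \<open>Joint states are functions of the agent; one linear map per agent is enough to carry
  measurability, square integrability and zero mean over to \<open>deep\<close> and
  \<open>dev\<close>.\<close>

definition agentwise_linear where
  "agentwise_linear f \<longleftrightarrow>
     (\<exists>L. (\<forall>k. linear (L k)) \<and> (\<forall>x::'n::finite \<Rightarrow> real^'h::finite. f x = (\<Sum>k\<in>UNIV. L k (x k))))"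

lemma agentwise_linear_deep: "agentwise_linear (deep \<alpha> :: _ \<Rightarrow> real^('z \<times> 'h::finite))"
  for \<alpha> :: "'n::finite \<Rightarrow> 'z::finite \<Rightarrow> real"
proof -
  define L where "L k v = (\<chi> p. \<alpha> k (fst p) * v $ snd p / real CARD('n))" for k :: 'n and v :: "real^'h"
  have "linear (L k)" for k
    by (rule linearI) (simp_all add: L_def vec_eq_iff add_divide_distrib distrib_left)
  moreover have "deep \<alpha> x = (\<Sum>k\<in>UNIV. L k (x k))" for x
    by (simp add: deep_def L_def vec_eq_iff sum_divide_distrib)
  ultimately show ?thesis unfolding agentwise_linear_def by blast
qed

lemma agentwise_linear_dev: "agentwise_linear (\<lambda>x. dev \<alpha> x i :: real^'h::finite)"
  for \<alpha> :: "'n::finite \<Rightarrow> 'z::finite \<Rightarrow> real"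
proof -
  \<comment> \<open>Row \<open>i\<close> of the projection matrix I - \<alpha> \<alpha>^T /
    n.\<close>
  define c where "c k = (if k = i then 1 else 0) - (\<Sum>j\<in>UNIV. \<alpha> i j * \<alpha> k j / real CARD('n))" for k
  have "dev \<alpha> x i = (\<Sum>k\<in>UNIV. c k *\<^sub>R x k)" for x :: "'n \<Rightarrow> real^'h"
  proof -
    have "(\<Sum>k\<in>UNIV. c k *\<^sub>R x k) = (\<Sum>k\<in>UNIV. if k = i then x k else 0)
        - (\<Sum>k\<in>UNIV. \<Sum>j\<in>UNIV. (\<alpha> i j * \<alpha> k j / real CARD('n)) *\<^sub>R x k)"
      unfolding sum_subtractf[symmetric]
      by (intro sum.cong) (auto simp: c_def scaleR_diff_left scaleR_sum_left)
    also have "(\<Sum>k\<in>UNIV. if k = i then x k else 0) = x i" by simp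
    also have "(\<Sum>k\<in>UNIV. \<Sum>j\<in>UNIV. (\<alpha> i j * \<alpha> k j / real CARD('n)) *\<^sub>R x k)
        = (\<Sum>j\<in>UNIV. \<Sum>k\<in>UNIV. (\<alpha> i j * \<alpha> k j / real CARD('n)) *\<^sub>R x k)" by (rule sum.swap)
    also have "\<dots> = (\<Sum>j\<in>UNIV. \<alpha> i j *\<^sub>R blk (deep \<alpha> x) j)"
      by (intro sum.cong) (auto simp: blk_deep scaleR_sum_right)
    finally show ?thesis by (simp add: dev_def)
  qed
  moreover have "linear (\<lambda>v::real^'h. c k *\<^sub>R v)" for k by (rule linear_scaleR)
  ultimately show ?thesis unfolding agentwise_linear_def by (intro exI[of _ "\<lambda>k v. c k *\<^sub>R v"]) auto
qed

section \<open>Comparison of discounted and average costs\<close>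

text \<open>If the right series diverges, its value is infinite. Otherwise fix \<open>T\<close> on
  the left and let the horizon grow: nonnegativity preserves the bound while the error
  vanishes.\<close>

lemma weighted_sum_nonneg_ereal_le:
  fixes c c' e :: "nat \<Rightarrow> real"
  assumes nn: "\<And>t. 0 \<le> c t" "\<And>t. 0 \<le> c' t"
    and partial: "\<And>T. (\<Sum>t<T. c t) \<le> (\<Sum>t<T. c' t) + e T"
    and e: "summable c' \<Longrightarrow> e \<longlonglongrightarrow> 0"
  shows "(\<Sum>t. ereal (c t)) \<le> (\<Sum>t. ereal (c' t))"
proof (cases "summable c'")
  case True
  have "(\<Sum>t<T. c t) \<le> suminf c'" for T
  proof -
    have "(\<lambda>T'. (\<Sum>t<T'. c' t) + e T') \<longlonglongrightarrow> suminf c' + 0"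
      using True e by (intro tendsto_add summable_LIMSEQ) auto
    moreover have "\<forall>\<^sub>F T' in sequentially. (\<Sum>t<T. c t) \<le> (\<Sum>t<T'. c' t) + e T'"
      using eventually_ge_at_top[of T]
    proof eventually_elim
      case (elim T')
      have "(\<Sum>t<T. c t) \<le> (\<Sum>t<T'. c t)" using elim nn by (intro sum_mono2) auto
      also note partial[of T']
      finally show ?case .
    qed
    ultimately show ?thesis using tendsto_lowerbound[of _ _ sequentially] by force
  qed
  then have "(\<Sum>t<T. ereal (c t)) \<le> ereal (suminf c')" for T by simp
  then have "(\<Sum>t. ereal (c t)) \<le> ereal (suminf c')"
    using nn by (intro suminf_bound) auto
  also have "\<dots> = (\<Sum>t. ereal (c' t))"
    using True by (intro sums_unique) (simp add: sums_ereal summable_sums)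
  finally show ?thesis .
next
  case False
  have "(\<Sum>t. ereal (c' t)) = \<infinity>"
    using False summable_ereal[of c'] nn by (cases "(\<Sum>t. ereal (c' t)) = \<infinity>") auto
  then show ?thesis by simp
qed

text \<open>Multiply the one-step inequality by \<open>\<beta> ^ t\<close> and sum. In the
  application \<open>v\<close> is an expected value and \<open>N\<close> the value of the noise, so
  the left side is common to all strategies.\<close>

lemma telescoped_cost_le:
  fixes v c N :: "nat \<Rightarrow> real"
  assumes "0 \<le> \<beta>" "\<And>t. v t \<le> c t + \<beta> * (v (Suc t) - N t)"
  shows "v 0 + (\<Sum>t<T. \<beta> ^ Suc t * N t) \<le> (\<Sum>t<T. \<beta> ^ t * c t) + \<beta> ^ T * v T"
proof (induction T)
  case (Suc T)
  have "\<beta> ^ T * v T \<le> \<beta> ^ T * (c T + \<beta> * (v (Suc T) - N T))"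
    using assms by (intro mult_left_mono) auto
  with Suc show ?case by (simp add: algebra_simps)
qed simp

lemma telescoped_cost_eq:
  fixes v c N :: "nat \<Rightarrow> real"
  assumes "\<And>t. v t = c t + \<beta> * (v (Suc t) - N t)"
  shows "v 0 + (\<Sum>t<T. \<beta> ^ Suc t * N t) = (\<Sum>t<T. \<beta> ^ t * c t) + \<beta> ^ T * v T"
proof (induction T)
  case (Suc T)
  have "\<beta> ^ T * v T = \<beta> ^ T * (c T + \<beta> * (v (Suc T) - N T))"
    using assms[of T] by (rule arg_cong)
  with Suc show ?case by (simp add: algebra_simps)
qed simp

text \<open>\<open>c\<close> is the running cost of the proposed strategy; the other sequences
  belong to a competitor: running cost \<open>c'\<close>, expected value \<open>v'\<close> and state
  energy \<open>a\<close>. \<open>D\<close> is an allowance for the noise.\<close>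

locale cost_comparison =
  fixes c c' v' a :: "nat \<Rightarrow> real" and \<beta> \<rho> K D :: real
  assumes \<beta>: "0 < \<beta>" "\<beta> \<le> 1" and \<rho>: "0 \<le> \<rho>" "\<rho> < 1" and K: "0 \<le> K" and D: "0 \<le> D"
    and c: "\<And>t. 0 \<le> c t" "\<And>t. 0 \<le> c' t"
    and v': "\<And>t. 0 \<le> v' t" "\<And>t. v' t \<le> K * a t"
    and a: "\<And>t. 0 \<le> a t" "\<And>t. a (Suc t) \<le> \<rho> * a t + K * (c' t + D)"
    and partial: "\<And>T. (\<Sum>t<T. \<beta> ^ t * c t) \<le> (\<Sum>t<T. \<beta> ^ t * c' t) + \<beta> ^ T * v' T"
begin

text \<open>A competitor of finite cost has summable discounted stage costs, so
  \<open>\<beta> ^ t * a t\<close> obeys a contracting recursion with vanishing input and the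
  terminal term disappears.\<close>

lemma discounted_le:
  assumes "\<beta> < 1"
  shows "(\<Sum>t. ereal (\<beta> ^ t * c t)) \<le> (\<Sum>t. ereal (\<beta> ^ t * c' t))"
proof (rule weighted_sum_nonneg_ereal_le[where e = "\<lambda>T. \<beta> ^ T * v' T"])
  assume s: "summable (\<lambda>t. \<beta> ^ t * c' t)"
  have "(\<lambda>t. \<beta> ^ t * a t) \<longlonglongrightarrow> 0"
  proof (rule contracting_recursion_tendsto_0[OF \<rho>])
    show "0 \<le> \<beta> ^ t * a t" for t using \<beta> a by simp
    show "(\<lambda>t. \<beta> * K * (\<beta> ^ t * c' t + \<beta> ^ t * D)) \<longlonglongrightarrow> 0"
    proof -
      have "(\<lambda>t. \<beta> * K * (\<beta> ^ t * c' t + \<beta> ^ t * D)) \<longlonglongrightarrow> \<beta> * K * (0 + 0 * D)"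
        using \<beta> assms by (intro tendsto_intros summable_LIMSEQ_zero[OF s] LIMSEQ_realpow_zero) auto
      then show ?thesis by simp
    qed
    show "\<beta> ^ Suc t * a (Suc t) \<le> \<rho> * (\<beta> ^ t * a t) + \<beta> * K * (\<beta> ^ t * c' t + \<beta> ^ t * D)" for t
    proof -
      have "\<beta> ^ Suc t * a (Suc t) \<le> \<beta> ^ Suc t * (\<rho> * a t + K * (c' t + D))"
        using a(2)[of t] \<beta> by (intro mult_left_mono) auto
      also have "\<dots> = \<beta> * (\<rho> * (\<beta> ^ t * a t)) + \<beta> * K * (\<beta> ^ t * c' t + \<beta> ^ t * D)"
        by (simp add: algebra_simps)
      also have "\<beta> * (\<rho> * (\<beta> ^ t * a t)) \<le> 1 * (\<rho> * (\<beta> ^ t * a t))"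
        using \<beta> \<rho> a by (intro mult_right_mono) auto
      finally show ?thesis by simp
    qed
  qed
  then have "(\<lambda>t. K * (\<beta> ^ t * a t)) \<longlonglongrightarrow> K * 0" by (intro tendsto_intros)
  moreover have "\<beta> ^ t * v' t \<le> K * (\<beta> ^ t * a t)" for t
    using mult_left_mono[OF v'(2)[of t], of "\<beta> ^ t"] \<beta> by (simp add: algebra_simps)
  ultimately show "(\<lambda>t. \<beta> ^ t * v' t) \<longlonglongrightarrow> 0"
    using \<beta> v' by - (rule real_tendsto_sandwich[of "\<lambda>_. 0" _ _ "\<lambda>t. K * (\<beta> ^ t * a t)"], auto)
next
  show "(\<Sum>t<T. \<beta> ^ t * c t) \<le> (\<Sum>t<T. \<beta> ^ t * c' t) + \<beta> ^ T * v' T" for T by (rule partial)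
qed (use \<beta> c in simp_all)

text \<open>The comparison of partial costs carries the terminal term \<open>v' T\<close>, which need not be \<open>o(T)\<close>.
  As the running cost is nonnegative, the horizon T may be replaced by any T' in [T, T + e T]; the average
  of \<open>v'\<close> over this window is bounded, so T' can be chosen with \<open>v' T'\<close> bounded.\<close>

lemma average_le:
  assumes "\<beta> = 1"
  shows "limsup (\<lambda>T. ereal ((\<Sum>t<T. c t) / real T)) \<le> limsup (\<lambda>T. ereal ((\<Sum>t<T. c' t) / real T))"
proof (rule dense_ge)
  fix y assume "limsup (\<lambda>T. ereal ((\<Sum>t<T. c' t) / real T)) < y"
  moreover have "0 \<le> limsup (\<lambda>T. ereal ((\<Sum>t<T. c' t) / real T))"
    using c by (intro le_Limsup always_eventually allI) (simp_all add: sum_nonneg)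
  ultimately have "\<exists>l. limsup (\<lambda>T. ereal ((\<Sum>t<T. c' t) / real T)) < ereal l \<and> ereal l < y"
    using ereal_dense2[of "limsup (\<lambda>T. ereal ((\<Sum>t<T. c' t) / real T))" y] by auto
  \<comment> \<open>A real level between the competitor's average and \<open>y\<close>: it bounds
    the cumulative cost linearly for large horizons.\<close>
  then obtain l where l: "limsup (\<lambda>T. ereal ((\<Sum>t<T. c' t) / real T)) < ereal l" "ereal l < y" by blast
  have "0 < ereal l" using \<open>0 \<le> limsup _\<close> l(1) by (rule order_le_less_trans)
  then have "0 < l" by simp
  have "\<forall>\<^sub>F T in sequentially. ereal ((\<Sum>t<T. c' t) / real T) < ereal l"
    using l(1) by (rule Limsup_lessD)
  then obtain T0 where T0: "\<And>T. T \<ge> T0 \<Longrightarrow> (\<Sum>t<T. c' t) / real T < l"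
    by (auto simp: eventually_sequentially)
  define T1 where "T1 = max 1 T0"
  have C': "(\<Sum>t<T. c' t) \<le> l * T" if "T \<ge> T1" for T
    using T0[of T] that by (simp add: T1_def field_simps)
  \<comment> \<open>Summing the energy recursion over \<open>t < T\<close> and solving for the sum
    of \<open>a\<close> gives this linear growth rate.\<close>
  define m where "m = (a 0 + K * (l + D)) / (1 - \<rho>)"
  have "m \<ge> 0" using a \<open>0 < l\<close> K D \<rho> by (simp add: m_def)
  have suma: "(\<Sum>t<T. a t) \<le> m * T" if "T \<ge> T1" for T
  proof -
    have "(\<Sum>t<Suc T. a t) = a 0 + (\<Sum>t<T. a (Suc t))" by (rule sum.lessThan_Suc_shift)
    also have "(\<Sum>t<T. a (Suc t)) \<le> (\<Sum>t<T. \<rho> * a t + K * (c' t + D))" by (intro sum_mono a)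
    also have "\<dots> = \<rho> * (\<Sum>t<T. a t) + K * ((\<Sum>t<T. c' t) + D * T)"
      by (simp add: sum.distrib sum_distrib_left algebra_simps)
    also have "\<dots> \<le> \<rho> * (\<Sum>t<T. a t) + K * (l * T + D * T)"
      using C'[OF that] K by (intro add_left_mono mult_left_mono) auto
    finally have "(1 - \<rho>) * (\<Sum>t<T. a t) \<le> a 0 + K * (l + D) * T"
      using a(1)[of T] by (simp add: algebra_simps)
    also have "\<dots> \<le> (a 0 + K * (l + D)) * T"
      using that mult_right_mono[of 1 "real T" "a 0", OF _ a(1)] by (simp add: T1_def algebra_simps)
    finally show ?thesis using \<rho> by (simp add: m_def field_simps)
  qed
  have key: "limsup (\<lambda>T. ereal ((\<Sum>t<T. c t) / real T)) \<le> ereal (l * (1 + e))" if "e > 0" for e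
  proof -
    \<comment> \<open>\<open>m * (1 / e + 1)\<close> will bound \<open>a\<close> at the chosen
      horizon; \<open>K\<close> turns this into a bound on \<open>v'\<close>.\<close>
    define B where "B = K * (m * (1 / e + 1))"
    have bound: "(\<Sum>t<T. c t) / real T \<le> l * (1 + e) + B / T" if "T \<ge> T1" for T
    proof -
      have "T > 0" using that by (simp add: T1_def)
      define k where "k = nat \<lceil>e * T\<rceil>"
      have k: "e * T \<le> k" "k < e * T + 1" using \<open>e > 0\<close> by (simp_all add: k_def) linarith
      have "0 < e * T" using \<open>e > 0\<close> \<open>T > 0\<close> by simp
      then have "0 < real k" using k(1) by linarith
      then have "k > 0" by simp
      \<comment> \<open>Were all \<open>k\<close> terms of the window above the threshold, their sum
        would exceed \<open>m * (T + k)\<close> because \<open>k \<ge> e * T\<close>.\<close>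
      have "\<exists>T'\<in>{T..<T + k}. a T' \<le> m * (1 / e + 1)"
      proof (rule ccontr)
        assume "\<not> ?thesis"
        then have "(\<Sum>t\<in>{T..<T + k}. m * (1 / e + 1)) < (\<Sum>t\<in>{T..<T + k}. a t)"
          using \<open>k > 0\<close> by (intro sum_strict_mono) (auto simp: not_le)
        also have "\<dots> \<le> (\<Sum>t<T + k. a t)" using a by (intro sum_mono2) auto
        also have "\<dots> \<le> m * (T + k)" using suma[of "T + k"] that by simp
        finally have "k * (m * (1 / e + 1)) < m * (T + k)" by simp
        then have "m * (k / e) < m * T" by (simp add: algebra_simps)
        moreover have "m * T \<le> m * (k / e)" using k(1) \<open>e > 0\<close> \<open>m \<ge> 0\<close>
          by (intro mult_left_mono) (simp_all add: field_simps)
        ultimately show False by simp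
      qed
      then obtain T' where T': "T \<le> T'" "T' < T + k" "a T' \<le> m * (1 / e + 1)" by auto
      \<comment> \<open>The window is half open, so \<open>T'\<close> is at most
        \<open>T + k - 1\<close>, which cancels the rounding in \<open>k\<close>.\<close>
      have "real T' \<le> T * (1 + e)" using T'(2) k(2) by (simp add: algebra_simps)
      have "(\<Sum>t<T. c t) \<le> (\<Sum>t<T'. c t)" using T' c by (intro sum_mono2) auto
      also have "\<dots> \<le> (\<Sum>t<T'. c' t) + v' T'" using partial[of T'] assms by simp
      also have "\<dots> \<le> l * T' + B"
        using C'[of T'] T' that v'(2)[of T'] mult_left_mono[OF T'(3) K] by (simp add: B_def)
      also have "\<dots> \<le> l * (T * (1 + e)) + B" using \<open>real T' \<le> _\<close> \<open>0 < l\<close> by simp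
      finally show ?thesis using \<open>T > 0\<close> by (simp add: field_simps)
    qed
    have "limsup (\<lambda>T. ereal ((\<Sum>t<T. c t) / real T)) \<le> limsup (\<lambda>T. ereal (l * (1 + e) + B / T))"
      using bound by (intro Limsup_mono) (auto simp: eventually_sequentially)
    also have "(\<lambda>T. ereal (l * (1 + e) + B / real T)) \<longlonglongrightarrow> ereal (l * (1 + e) + 0)"
      by (intro tendsto_intros tendsto_ereal tendsto_divide_0[OF tendsto_const] filterlim_real_sequentially
          filterlim_at_top_imp_at_infinity)
    then have "limsup (\<lambda>T. ereal (l * (1 + e) + B / real T)) = ereal (l * (1 + e))"
      by (simp add: lim_imp_Limsup)
    finally show ?thesis .
  qed
  have "limsup (\<lambda>T. ereal ((\<Sum>t<T. c t) / real T)) \<le> ereal l"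
  proof (rule ereal_le_epsilon2)
    fix d :: real assume "0 < d"
    \<comment> \<open>A relative window length of \<open>d / l\<close> costs exactly
      \<open>d\<close> in the average.\<close>
    have "l * (1 + d / l) = l + d" using \<open>0 < l\<close> by (simp add: field_simps)
    then show "limsup (\<lambda>T. ereal ((\<Sum>t<T. c t) / real T)) \<le> ereal l + ereal d"
      using key[of "d / l"] \<open>0 < l\<close> \<open>0 < d\<close> by simp
  qed
  then show "limsup (\<lambda>T. ereal ((\<Sum>t<T. c t) / real T)) \<le> y" using l(2) by (rule order_trans[OF _ less_imp_le])
qed

end

section \<open>Square integrable and independent random vectors\<close>

definition square_integrable :: "'w measure \<Rightarrow> ('w \<Rightarrow> 'a::euclidean_space) \<Rightarrow> bool" where
  "square_integrable M Y \<longleftrightarrow> Y \<in> borel_measurable M \<and> integrable M (\<lambda>\<omega>. (norm (Y \<omega>))\<^sup>2)"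

lemma square_integrable_bound:
  assumes "square_integrable M Y" "h \<in> borel_measurable borel" "\<And>y. \<bar>h y\<bar> \<le> K * (norm y)\<^sup>2"
  shows "integrable M (\<lambda>\<omega>. h (Y \<omega>) :: real)"
proof (rule Bochner_Integration.integrable_bound)
  show "integrable M (\<lambda>\<omega>. K * (norm (Y \<omega>))\<^sup>2)" using assms by (simp add: square_integrable_def)
  show "(\<lambda>\<omega>. h (Y \<omega>)) \<in> borel_measurable M"
    using assms unfolding square_integrable_def by (intro measurable_compose[OF _ assms(2)]) auto
  show "AE \<omega> in M. norm (h (Y \<omega>)) \<le> norm (K * (norm (Y \<omega>))\<^sup>2)"
    by (intro AE_I2) (simp only: real_norm_def order_trans[OF assms(3) abs_ge_self])
qed

lemma square_integrable_add:
  assumes "square_integrable M Y" "square_integrable M Z"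
  shows "square_integrable M (\<lambda>\<omega>. Y \<omega> + Z \<omega>)"
proof -
  have meas: "(\<lambda>\<omega>. Y \<omega> + Z \<omega>) \<in> borel_measurable M"
    using assms unfolding square_integrable_def by (intro borel_measurable_add) auto
  have "(norm (a + b))\<^sup>2 \<le> 2 * (norm a)\<^sup>2 + 2 * (norm b)\<^sup>2" for a b :: 'b
  proof -
    have "0 \<le> (norm (a - b))\<^sup>2" by simp
    then show ?thesis unfolding power2_norm_eq_inner
      by (simp add: inner_add_left inner_add_right inner_diff_left inner_diff_right inner_commute)
  qed
  moreover have "integrable M (\<lambda>\<omega>. 2 * (norm (Y \<omega>))\<^sup>2 + 2 * (norm (Z \<omega>))\<^sup>2)"
    using assms by (simp add: square_integrable_def)
  moreover have "(\<lambda>\<omega>. (norm (Y \<omega> + Z \<omega>))\<^sup>2) \<in> borel_measurable M" using meas by simp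
  ultimately have "integrable M (\<lambda>\<omega>. (norm (Y \<omega> + Z \<omega>))\<^sup>2)"
    by (elim Bochner_Integration.integrable_bound) simp_all
  with meas show ?thesis by (simp add: square_integrable_def)
qed

lemma square_integrable_linear:
  assumes "square_integrable M Y" "linear f"
  shows "square_integrable M (\<lambda>\<omega>. f (Y \<omega>) :: 'b::euclidean_space)"
proof -
  obtain K where K: "\<And>y. norm (f y) \<le> K * norm y" using linear_bounded[OF assms(2)] by blast
  have f: "f \<in> borel_measurable borel"
    using assms(2) by (intro borel_measurable_continuous_onI linear_continuous_on) (simp add: linear_conv_bounded_linear)
  have "\<bar>(norm (f y))\<^sup>2\<bar> \<le> K\<^sup>2 * (norm y)\<^sup>2" for y
    using power_mono[OF K[of y], of 2] by (simp add: power_mult_distrib)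
  then have "integrable M (\<lambda>\<omega>. (norm (f (Y \<omega>)))\<^sup>2)"
    using f by (intro square_integrable_bound[OF assms(1)]) auto
  then show ?thesis using assms measurable_compose[OF _ f] by (auto simp: square_integrable_def)
qed

lemma square_integrable_0: "square_integrable M (\<lambda>\<omega>. 0)"
  by (simp add: square_integrable_def)

lemma square_integrable_sum:
  "(\<And>i. i \<in> I \<Longrightarrow> square_integrable M (Y i)) \<Longrightarrow> square_integrable M (\<lambda>\<omega>. \<Sum>i\<in>I. Y i \<omega>)"
  by (induction I rule: infinite_finite_induct) (auto intro: square_integrable_add square_integrable_0)

lemma square_integrable_qf:
  assumes "square_integrable M Y" shows "integrable M (\<lambda>\<omega>. qf P (Y \<omega>))"
proof -
  obtain K where K: "\<And>x. norm (P *v x) \<le> K * norm x" using norm_mult_vec_le by blast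
  have "\<bar>qf P x\<bar> \<le> K * (norm x)\<^sup>2" for x
    using Cauchy_Schwarz_ineq2[of x "P *v x"] mult_left_mono[OF K[of x], of "norm x"]
    by (simp add: qf_def power2_eq_square algebra_simps)
  then show ?thesis
    using borel_measurable_continuous_onI[OF continuous_on_qf] by (rule square_integrable_bound[OF assms, rotated])
qed

lemma (in prob_space) integrable_if_square_integrable:
  assumes "square_integrable M Y" shows "integrable M Y"
proof (rule Bochner_Integration.integrable_bound)
  show "integrable M (\<lambda>\<omega>. 1 + (norm (Y \<omega>))\<^sup>2)" using assms by (simp add: square_integrable_def)
  have "norm y \<le> 1 + (norm y)\<^sup>2" for y :: 'b
  proof -
    have "2 * norm y \<le> (norm y)\<^sup>2 + 1" using sum_squares_bound[of "norm y" 1] by simp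
    then show ?thesis using norm_ge_zero[of y] by linarith
  qed
  then show "AE \<omega> in M. norm (Y \<omega>) \<le> norm (1 + (norm (Y \<omega>))\<^sup>2)" by simp
qed (use assms in \<open>simp add: square_integrable_def\<close>)

text \<open>The cross term splits over coordinates into products of independent integrable scalars,
  one of which has mean zero.\<close>

lemma (in prob_space) expectation_qf_add:
  fixes Y N :: "'a \<Rightarrow> real^'n"
  assumes indep: "indep_var borel Y borel N" and Y: "square_integrable M Y" and N: "square_integrable M N"
    and zero: "expectation N = 0" and "symm P"
  shows "expectation (\<lambda>\<omega>. qf P (Y \<omega> + N \<omega>)) = expectation (\<lambda>\<omega>. qf P (Y \<omega>)) + expectation (\<lambda>\<omega>. qf P (N \<omega>))"
proof -
  have iN: "integrable M N" and iY: "integrable M Y"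
    by (rule integrable_if_square_integrable, fact)+
  have bl: "bounded_linear (\<lambda>x. (P *v x) \<bullet> b)" for b
    by (intro bounded_linear_compose[OF bounded_linear_inner_left]) simp
  have b: "integrable M (\<lambda>\<omega>. (Y \<omega> \<bullet> b) * ((P *v N \<omega>) \<bullet> b)) \<and>
      expectation (\<lambda>\<omega>. (Y \<omega> \<bullet> b) * ((P *v N \<omega>) \<bullet> b)) = 0" for b
  proof -
    have ind: "indep_var borel (\<lambda>\<omega>. Y \<omega> \<bullet> b) borel (\<lambda>\<omega>. (P *v N \<omega>) \<bullet> b)"
      using indep_var_compose[OF indep, of "\<lambda>x. x \<bullet> b" borel "\<lambda>x. (P *v x) \<bullet> b" borel]
        borel_measurable_continuous_onI[OF linear_continuous_on[OF bl]]
      by (simp add: comp_def)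
    have i: "integrable M (\<lambda>\<omega>. Y \<omega> \<bullet> b)" "integrable M (\<lambda>\<omega>. (P *v N \<omega>) \<bullet> b)"
      using iY integrable_bounded_linear[OF bl iN] by auto
    have "expectation (\<lambda>\<omega>. (P *v N \<omega>) \<bullet> b) = (P *v expectation N) \<bullet> b"
      using integral_bounded_linear[OF bl iN] .
    then show ?thesis
      using indep_var_integrable[OF ind i] indep_var_lebesgue_integral[OF ind i] zero by simp
  qed
  have cross: "integrable M (\<lambda>\<omega>. Y \<omega> \<bullet> (P *v N \<omega>))" "expectation (\<lambda>\<omega>. Y \<omega> \<bullet> (P *v N \<omega>)) = 0"
  proof -
    have e: "(\<lambda>\<omega>. Y \<omega> \<bullet> (P *v N \<omega>)) = (\<lambda>\<omega>. \<Sum>b\<in>Basis. (Y \<omega> \<bullet> b) * ((P *v N \<omega>) \<bullet> b))"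
      by (rule ext, rule euclidean_inner)
    show "integrable M (\<lambda>\<omega>. Y \<omega> \<bullet> (P *v N \<omega>))" "expectation (\<lambda>\<omega>. Y \<omega> \<bullet> (P *v N \<omega>)) = 0"
      unfolding e using b by simp_all
  qed
  have eq: "qf P (Y \<omega> + N \<omega>) = qf P (Y \<omega>) + qf P (N \<omega>) + 2 * (Y \<omega> \<bullet> (P *v N \<omega>))" for \<omega>
    using symm_inner[OF \<open>symm P\<close>, of "Y \<omega>" "N \<omega>"] by (simp add: qf_add)
  show ?thesis unfolding eq
    using square_integrable_qf[OF Y] square_integrable_qf[OF N] cross by simp
qed

section \<open>Generated sigma-algebras and independence from the rest\<close>

lemma measurable_sigma_imp_preimage:
  assumes "f \<in> measurable (sigma (space M) A) N" "A \<subseteq> Pow (space M)" "S \<in> sets N"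
  shows "f -` S \<inter> space M \<in> sigma_sets (space M) A"
  using measurable_sets[OF assms(1,3)] assms(2) by (simp add: space_measure_of_conv sets_measure_of)

lemma measurable_sigma_mono:
  assumes "f \<in> borel_measurable (sigma (space M) A)" "A \<subseteq> sets M"
  shows "f \<in> borel_measurable M"
proof (rule measurableI)
  have A: "A \<subseteq> Pow (space M)" using assms(2) sets.sets_into_space by blast
  show "f -` S \<inter> space M \<in> sets M" if "S \<in> sets borel" for S
    using measurable_sigma_imp_preimage[OF assms(1) A that] sets.sigma_sets_subset[OF assms(2)] by blast
qed simp

text \<open>Independent intersection-stable generators over disjoint index sets generate independent
  sigma-algebras; here the index sets are \<open>k\<close> alone and everything else.\<close>

lemma (in prob_space) indep_var_rest:
  fixes Y N :: "'a \<Rightarrow> 'b::topological_space"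
  assumes indep: "indep_sets E UNIV" and stable: "\<And>i. Int_stable (E i)"
    and Y: "Y \<in> borel_measurable (sigma (space M) (\<Union>i\<in>-{k}. E i))"
    and N: "N \<in> borel_measurable (sigma (space M) (E k))"
  shows "indep_var borel Y borel N"
proof -
  \<comment> \<open>\<open>indep_var\<close> is independence of a family indexed by bool, so the two
    groups are indexed likewise.\<close>
  define G where "G b = (if b then - {k} else {k})" for b
  have E: "E i \<subseteq> Pow (space M)" "E i \<subseteq> events" for i
    using indep sets.sets_into_space by (auto simp: indep_sets_def)
  have "indep_sets (\<lambda>b. sigma_sets (space M) (\<Union>i\<in>G b. E i)) UNIV"
  proof (rule indep_sets_collect_sigma)
    have "(\<Union>b. G b) = UNIV" by (auto simp: G_def split: if_splits)
    then show "indep_sets E (\<Union>b. G b)" using indep by simp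
    show "disjoint_family G" by (auto simp: disjoint_family_on_def G_def)
  qed (rule stable)
  moreover have meas: "case_bool Y N b \<in> borel_measurable (sigma (space M) (\<Union>i\<in>G b. E i))" for b
    using Y N by (cases b) (simp_all add: G_def)
  have "{case_bool Y N b -` A \<inter> space M |A. A \<in> sets borel} \<subseteq> sigma_sets (space M) (\<Union>i\<in>G b. E i)" for b
    using measurable_sigma_imp_preimage[OF meas] E(1) by blast
  moreover have "random_variable borel (case_bool Y N b)" for b
    using E(2) by (intro measurable_sigma_mono[OF meas]) blast
  moreover have "case_bool borel borel b = (borel :: 'b measure)" for b by (cases b) simp_all
  ultimately show ?thesis
    unfolding indep_var_def indep_vars_def2 by (auto intro: indep_sets_mono_sets)
qed

text \<open>Expectations of the pathwise relations in one subsystem. Independence and centring enter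
  in the Bellman part, where they split the value of the next state into that of the drift and that
  of the noise.\<close>

lemma (in prob_space) subsystem_estimates:
  fixes Y N :: "nat \<Rightarrow> 'a \<Rightarrow> real^'k" and U :: "nat \<Rightarrow> 'a \<Rightarrow> real^'m"
  assumes Y: "\<And>t. square_integrable M (Y t)" and U: "\<And>t. square_integrable M (U t)"
    and N: "\<And>t. square_integrable M (N t)"
    and dyn: "\<And>t \<omega>. Y (Suc t) \<omega> = A *v Y t \<omega> + B *v U t \<omega> + N t \<omega>"
    and ind: "\<And>t. indep_var borel (\<lambda>\<omega>. A *v Y t \<omega> + B *v U t \<omega>) borel (N t)"
    and zero: "\<And>t. expectation (N t) = 0"
  shows bellman_expectation_le: "symm P \<Longrightarrow> bellman \<beta> A B Q R P \<theta> \<Longrightarrow>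
      expectation (\<lambda>\<omega>. qf P (Y t \<omega>)) \<le> expectation (\<lambda>\<omega>. qf Q (Y t \<omega>)) + expectation (\<lambda>\<omega>. qf R (U t \<omega>))
        + \<beta> * (expectation (\<lambda>\<omega>. qf P (Y (Suc t) \<omega>)) - expectation (\<lambda>\<omega>. qf P (N t \<omega>)))"
    and bellman_expectation_eq: "symm P \<Longrightarrow> bellman \<beta> A B Q R P \<theta> \<Longrightarrow> (\<And>\<omega>. U t \<omega> = \<theta> *v Y t \<omega>) \<Longrightarrow>
      expectation (\<lambda>\<omega>. qf P (Y t \<omega>)) = expectation (\<lambda>\<omega>. qf Q (Y t \<omega>)) + expectation (\<lambda>\<omega>. qf R (U t \<omega>))
        + \<beta> * (expectation (\<lambda>\<omega>. qf P (Y (Suc t) \<omega>)) - expectation (\<lambda>\<omega>. qf P (N t \<omega>)))"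
    and dissipative_integrable: "dissipative A B Q R S \<rho> K \<Longrightarrow> integrable M (\<lambda>\<omega>. S (Y t \<omega>))"
    and dissipative_expectation_le: "dissipative A B Q R S \<rho> K \<Longrightarrow>
      expectation (\<lambda>\<omega>. S (Y (Suc t) \<omega>)) \<le> \<rho> * expectation (\<lambda>\<omega>. S (Y t \<omega>))
        + K * (expectation (\<lambda>\<omega>. qf Q (Y t \<omega>)) + expectation (\<lambda>\<omega>. qf R (U t \<omega>))
               + expectation (\<lambda>\<omega>. (norm (N t \<omega>))\<^sup>2))"
proof -
  define Z where "Z \<omega> = A *v Y t \<omega> + B *v U t \<omega>" for \<omega>
  have Z: "square_integrable M Z"
    unfolding Z_def by (intro square_integrable_add square_integrable_linear[OF Y] square_integrable_linear[OF U]) simp_all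
  note int = square_integrable_qf[OF Y] square_integrable_qf[OF U] square_integrable_qf[OF N] square_integrable_qf[OF Z]
  have EV: "expectation (\<lambda>\<omega>. qf P (Y (Suc t) \<omega>)) - expectation (\<lambda>\<omega>. qf P (N t \<omega>)) = expectation (\<lambda>\<omega>. qf P (Z \<omega>))"
    if "symm P"
    using expectation_qf_add[OF ind[of t] Z[unfolded Z_def] N zero that] by (simp add: dyn Z_def)
  have E3: "expectation (\<lambda>\<omega>. qf Q (Y t \<omega>) + qf R (U t \<omega>) + \<beta> * qf P (Z \<omega>))
      = expectation (\<lambda>\<omega>. qf Q (Y t \<omega>)) + expectation (\<lambda>\<omega>. qf R (U t \<omega>)) + \<beta> * expectation (\<lambda>\<omega>. qf P (Z \<omega>))"
    using int by simp
  {
    assume "symm P" and b: "bellman \<beta> A B Q R P \<theta>"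
    have "qf P (Y t \<omega>) \<le> qf Q (Y t \<omega>) + qf R (U t \<omega>) + \<beta> * qf P (Z \<omega>)" for \<omega>
      using b unfolding bellman_def Z_def by blast
    then have "expectation (\<lambda>\<omega>. qf P (Y t \<omega>)) \<le> expectation (\<lambda>\<omega>. qf Q (Y t \<omega>) + qf R (U t \<omega>) + \<beta> * qf P (Z \<omega>))"
      using int by (intro integral_mono) auto
    then show "expectation (\<lambda>\<omega>. qf P (Y t \<omega>)) \<le> expectation (\<lambda>\<omega>. qf Q (Y t \<omega>)) + expectation (\<lambda>\<omega>. qf R (U t \<omega>))
        + \<beta> * (expectation (\<lambda>\<omega>. qf P (Y (Suc t) \<omega>)) - expectation (\<lambda>\<omega>. qf P (N t \<omega>)))"
      unfolding EV[OF \<open>symm P\<close>] E3 .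
    assume u: "\<And>\<omega>. U t \<omega> = \<theta> *v Y t \<omega>"
    have "qf P (Y t \<omega>) = qf Q (Y t \<omega>) + qf R (U t \<omega>) + \<beta> * qf P (Z \<omega>)" for \<omega>
      using b unfolding bellman_def Z_def u by blast
    then have "expectation (\<lambda>\<omega>. qf P (Y t \<omega>)) = expectation (\<lambda>\<omega>. qf Q (Y t \<omega>) + qf R (U t \<omega>) + \<beta> * qf P (Z \<omega>))"
      by (rule Bochner_Integration.integral_cong[OF refl])
    then show "expectation (\<lambda>\<omega>. qf P (Y t \<omega>)) = expectation (\<lambda>\<omega>. qf Q (Y t \<omega>)) + expectation (\<lambda>\<omega>. qf R (U t \<omega>))
        + \<beta> * (expectation (\<lambda>\<omega>. qf P (Y (Suc t) \<omega>)) - expectation (\<lambda>\<omega>. qf P (N t \<omega>)))"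
      unfolding EV[OF \<open>symm P\<close>] E3 .
  next
    assume d: "dissipative A B Q R S \<rho> K"
    have "\<bar>S y\<bar> \<le> K * (norm y)\<^sup>2" for y
      using d unfolding dissipative_def by (smt (verit) zero_le_power2)
    moreover have "S \<in> borel_measurable borel"
      using d unfolding dissipative_def by (intro borel_measurable_continuous_onI) blast
    ultimately have S: "integrable M (\<lambda>\<omega>. S (Y t \<omega>))" for t
      by (intro square_integrable_bound[OF Y])
    then show "integrable M (\<lambda>\<omega>. S (Y t \<omega>))" .
    have n: "integrable M (\<lambda>\<omega>. (norm (N t \<omega>))\<^sup>2)" using N by (simp add: square_integrable_def)
    have "S (Y (Suc t) \<omega>) \<le> \<rho> * S (Y t \<omega>) + K * (qf Q (Y t \<omega>) + qf R (U t \<omega>) + (norm (N t \<omega>))\<^sup>2)" for \<omega>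
      using d unfolding dissipative_def dyn by blast
    then have "expectation (\<lambda>\<omega>. S (Y (Suc t) \<omega>)) \<le>
        expectation (\<lambda>\<omega>. \<rho> * S (Y t \<omega>) + K * (qf Q (Y t \<omega>) + qf R (U t \<omega>) + (norm (N t \<omega>))\<^sup>2))"
      using S int n by (intro integral_mono) auto
    then show "expectation (\<lambda>\<omega>. S (Y (Suc t) \<omega>)) \<le> \<rho> * expectation (\<lambda>\<omega>. S (Y t \<omega>))
        + K * (expectation (\<lambda>\<omega>. qf Q (Y t \<omega>)) + expectation (\<lambda>\<omega>. qf R (U t \<omega>))
               + expectation (\<lambda>\<omega>. (norm (N t \<omega>))\<^sup>2))"
      using S int n by simp
  }
qed

section \<open>Random joint states, strategies and the generators of the primitives\<close>

lemma agentwise_linear_square_integrable: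
  assumes "agentwise_linear f" "\<And>i. square_integrable M (\<lambda>\<omega>. x \<omega> i)"
  shows "square_integrable M (\<lambda>\<omega>. f (x \<omega>) :: 'b::euclidean_space)"
proof -
  obtain L where L: "\<And>k. linear (L k)" "\<And>x. f x = (\<Sum>k\<in>UNIV. L k (x k))"
    using assms(1) unfolding agentwise_linear_def by blast
  show ?thesis unfolding L(2)
    by (intro square_integrable_sum square_integrable_linear[OF assms(2) L(1)])
qed

lemma agentwise_linear_borel_measurable:
  assumes "agentwise_linear f" "\<And>i. (\<lambda>\<omega>. x \<omega> i) \<in> borel_measurable N"
  shows "(\<lambda>\<omega>. f (x \<omega>) :: 'b::euclidean_space) \<in> borel_measurable N"
proof -
  obtain L where L: "\<And>k. linear (L k)" "\<And>x. f x = (\<Sum>k\<in>UNIV. L k (x k))"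
    using assms(1) unfolding agentwise_linear_def by blast
  have "L k \<in> borel_measurable borel" for k
    using L(1) by (intro borel_measurable_continuous_onI linear_continuous_on) (simp add: linear_conv_bounded_linear)
  then show ?thesis unfolding L(2)
    by (intro borel_measurable_sum) (rule measurable_compose[OF assms(2)])
qed

lemma (in prob_space) agentwise_linear_expectation_0:
  assumes "agentwise_linear f" "\<And>i. square_integrable M (\<lambda>\<omega>. x \<omega> i)" "\<And>i. expectation (\<lambda>\<omega>. x \<omega> i) = 0"
  shows "expectation (\<lambda>\<omega>. f (x \<omega>) :: 'b::euclidean_space) = 0"
proof -
  obtain L where L: "\<And>k. bounded_linear (L k)" "\<And>x. f x = (\<Sum>k\<in>UNIV. L k (x k))"
    using assms(1) unfolding agentwise_linear_def linear_conv_bounded_linear by blast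
  have i: "integrable M (\<lambda>\<omega>. x \<omega> k)" for k using assms(2) integrable_if_square_integrable by blast
  have "expectation (\<lambda>\<omega>. f (x \<omega>)) = (\<Sum>k\<in>UNIV. expectation (\<lambda>\<omega>. L k (x \<omega> k)))"
    unfolding L(2) using integrable_bounded_linear[OF L(1) i] by (intro Bochner_Integration.integral_sum)
  also have "\<dots> = 0"
    using integral_bounded_linear[OF L(1) i] assms(3) linear_0[OF bounded_linear.linear[OF L(1)]] by simp
  finally show ?thesis .
qed

lemma linear_blk: "linear (\<lambda>v. blk v j)"
  by (rule linearI) (simp_all add: blk_def vec_eq_iff)

lemma borel_measurable_matrix_vector_mult:
  "f \<in> borel_measurable N \<Longrightarrow> (\<lambda>\<omega>. A *v f \<omega>) \<in> borel_measurable N" for f :: "_ \<Rightarrow> real^'n"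
  by (rule measurable_compose[OF _ borel_measurable_continuous_onI[OF matrix_vector_mult_linear_continuous_on]])

definition measurable_strategy where
  "measurable_strategy g \<longleftrightarrow> (\<forall>t i. (\<lambda>(x, xb, r). g t i x xb r) \<in> borel_measurable borel)"

lemma ctrl_measurable:
  assumes "measurable_strategy g" "\<And>i. (\<lambda>\<omega>. x \<omega> i) \<in> borel_measurable N" "\<And>i. \<Xi> t i \<in> borel_measurable N"
  shows "(\<lambda>\<omega>. ctrl \<alpha> \<Xi> g t (x \<omega>) \<omega> i) \<in> borel_measurable N"
proof -
  have "(\<lambda>\<omega>. (x \<omega> i, deep \<alpha> (x \<omega>), \<Xi> t i \<omega>)) \<in> borel_measurable N"
    by (intro borel_measurable_Pair assms agentwise_linear_borel_measurable[OF agentwise_linear_deep])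
  from measurable_compose[OF this, of "\<lambda>(x, xb, r). g t i x xb r" borel] assms(1)
  show ?thesis by (simp add: measurable_strategy_def ctrl_def)
qed

text \<open>One generator per time collects the noises of all agents, which may therefore be
  correlated at equal times; each randomization variable has a generator of its own.
  \<open>Inl None\<close> stands for the initial states.\<close>

definition prim_sets where
  "prim_sets M X0 W \<Xi> = (\<lambda>k. case k of
      Inl p \<Rightarrow> {prim X0 W p -` S \<inter> space M | S. S \<in> sets borel}
    | Inr (t, i) \<Rightarrow> {\<Xi> t i -` S \<inter> space M | S. S \<in> sets borel})"

lemma Int_stable_preimages: "Int_stable {f -` S \<inter> A | S. S \<in> sets N}"
proof (rule Int_stableI, clarify)
  fix S T assume "S \<in> sets N" "T \<in> sets N"
  then show "\<exists>U. (f -` S \<inter> A) \<inter> (f -` T \<inter> A) = f -` U \<inter> A \<and> U \<in> sets N"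
    by (intro exI[of _ "S \<inter> T"]) auto
qed

lemma Int_stable_prim_sets: "Int_stable (prim_sets M X0 W \<Xi> k)"
  unfolding prim_sets_def by (auto split: sum.split intro: Int_stable_preimages)

lemma measurable_sigma_preimages:
  assumes "\<And>S. S \<in> sets borel \<Longrightarrow> f -` S \<inter> X \<in> E" "E \<subseteq> Pow X"
  shows "f \<in> borel_measurable (sigma X E)"
  using assms by (intro measurableI) (auto simp: sets_measure_of space_measure_of_conv)

section \<open>The team problem\<close>

text \<open>A common frame for both coupling models: \<open>cpl\<close> and \<open>cc\<close> stay
  abstract and are tied to the deep-state matrices by two compatibility equations, while Riccati and
  detectability hypotheses appear as Bellman and dissipation properties.\<close>

locale lq_team = prob_space M for M :: "'w measure" +
  fixes \<alpha> :: "'n::finite \<Rightarrow> 'z::finite \<Rightarrow> real" and \<beta> :: real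
    and A :: "real^'hx::finite^'hx" and B :: "real^'hu::finite^'hx"
    and Q :: "real^'hx^'hx" and R :: "real^'hu^'hu" and P :: "real^'hx^'hx" and \<theta> :: "real^'hx^'hu"
    and X0 :: "'n \<Rightarrow> 'w \<Rightarrow> real^'hx" and W :: "nat \<Rightarrow> 'n \<Rightarrow> 'w \<Rightarrow> real^'hx"
    and \<Xi> :: "nat \<Rightarrow> 'n \<Rightarrow> 'w \<Rightarrow> real"
    and cpl :: "'z \<Rightarrow> real^('z \<times> 'hx) \<Rightarrow> real^('z \<times> 'hu) \<Rightarrow> real^'hx"
    and cc :: "real^('z \<times> 'hx) \<Rightarrow> real^('z \<times> 'hu) \<Rightarrow> real"
    and Ab :: "real^('z \<times> 'hx)^('z \<times> 'hx)" and Bb :: "real^('z \<times> 'hu)^('z \<times> 'hx)"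
    and Qb :: "real^('z \<times> 'hx)^('z \<times> 'hx)" and Rb :: "real^('z \<times> 'hu)^('z \<times> 'hu)"
    and Pb :: "real^('z \<times> 'hx)^('z \<times> 'hx)" and \<theta>b :: "real^('z \<times> 'hx)^('z \<times> 'hu)"
    and gs :: "nat \<Rightarrow> 'n \<Rightarrow> real^'hx \<Rightarrow> real^('z \<times> 'hx) \<Rightarrow> real \<Rightarrow> real^'hu"
  assumes primitives: "primitives_ok M X0 W \<Xi>"
    and orth: "orthonormal_factors \<alpha>"
    and \<beta>: "0 < \<beta>" "\<beta> \<le> 1"
    and psd: "psd Q" "psd R" "psd Qb" "psd Rb" "psd P" "psd Pb"
    and symP: "symm P" "symm Pb"
    and bellman: "bellman \<beta> A B Q R P \<theta>" "bellman \<beta> Ab Bb Qb Rb Pb \<theta>b"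
    and dissipative: "\<exists>S \<rho> K. dissipative A B Q R S \<rho> K" "\<exists>S \<rho> K. dissipative Ab Bb Qb Rb S \<rho> K"
    and cpl: "\<And>j xb ub. A *v blk xb j + B *v blk ub j + cpl j xb ub = blk (Ab *v xb + Bb *v ub) j"
    and cc: "\<And>xb ub. (\<Sum>j\<in>UNIV. qf Q (blk xb j)) + (\<Sum>j\<in>UNIV. qf R (blk ub j)) + cc xb ub = qf Qb xb + qf Rb ub"
    and gs: "\<And>t i x xb r. gs t i x xb r
      = \<theta> *v x + (\<Sum>j\<in>UNIV. \<alpha> i j *\<^sub>R (blk (\<theta>b *v xb) j - \<theta> *v blk xb j))"
begin

abbreviation "xs \<equiv> traj A B \<alpha> cpl X0 W \<Xi>"
abbreviation "us \<equiv> acts A B \<alpha> cpl X0 W \<Xi>"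
abbreviation "adm \<equiv> admissible M A B \<alpha> cpl X0 W \<Xi>"

section \<open>Dynamics and cost in the split coordinates\<close>

lemma xs_Suc: "xs g (Suc t) \<omega> = (\<lambda>i. A *v xs g t \<omega> i + B *v us g t \<omega> i
    + (\<Sum>j\<in>UNIV. \<alpha> i j *\<^sub>R cpl j (deep \<alpha> (xs g t \<omega>)) (deep \<alpha> (us g t \<omega>))) + W t i \<omega>)"
  by (simp add: Let_def acts_def)

lemma deep_Suc: "deep \<alpha> (xs g (Suc t) \<omega>)
    = Ab *v deep \<alpha> (xs g t \<omega>) + Bb *v deep \<alpha> (us g t \<omega>) + deep \<alpha> (\<lambda>i. W t i \<omega>)"
  unfolding xs_Suc by (rule deep_decoupling[OF orth cpl])

lemma dev_Suc: "dev \<alpha> (xs g (Suc t) \<omega>) i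
    = A *v dev \<alpha> (xs g t \<omega>) i + B *v dev \<alpha> (us g t \<omega>) i + dev \<alpha> (\<lambda>i. W t i \<omega>) i"
  unfolding xs_Suc by (rule dev_decoupling[OF orth])

text \<open>\<open>cc\<close> supplies exactly what the blockwise \<open>Q\<close> and
  \<open>R\<close> terms lack to become the deep-state cost.\<close>

lemma stage_cost_decoupled: "stage_cost Q R \<alpha> cc x u =
    (\<Sum>i\<in>UNIV. qf Q (dev \<alpha> x i) + qf R (dev \<alpha> u i)) / real CARD('n) + (qf Qb (deep \<alpha> x) + qf Rb (deep \<alpha> u))"
proof -
  have "stage_cost Q R \<alpha> cc x u = (\<Sum>i\<in>UNIV. qf Q (x i)) / real CARD('n) + (\<Sum>i\<in>UNIV. qf R (u i)) / real CARD('n)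
      + cc (deep \<alpha> x) (deep \<alpha> u)"
    by (simp add: stage_cost_def sum.distrib add_divide_distrib)
  then show ?thesis
    using sum_qf_decoupling[OF orth, of Q x] sum_qf_decoupling[OF orth, of R u] cc[of "deep \<alpha> x" "deep \<alpha> u"]
    by (simp add: sum.distrib add_divide_distrib)
qed

section \<open>Measurability, square integrability and independence of trajectories\<close>

lemma X0_square_integrable: "square_integrable M (X0 i)"
  and W_square_integrable: "square_integrable M (W t i)" and W_zero: "expectation (W t i) = 0"
  and \<Xi>_measurable: "\<Xi> t i \<in> borel_measurable M"
  using primitives by (auto simp: primitives_ok_def square_integrable_def)

lemma W_bounded: obtains C where "\<And>t i. expectation (\<lambda>\<omega>. (norm (W t i \<omega>))\<^sup>2) \<le> C"
  using primitives that unfolding primitives_ok_def by blast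

lemma indep_prim_sets: "indep_sets (prim_sets M X0 W \<Xi>) UNIV"
  using primitives by (auto simp: primitives_ok_def prim_sets_def)

lemma prim_sets_Pow: "prim_sets M X0 W \<Xi> k \<subseteq> Pow (space M)"
  by (auto simp: prim_sets_def split: sum.splits)

text \<open>Compatibility determines the coupling, which is how its linearity and measurability are
  obtained.\<close>

lemma cpl_eq: "cpl j xb ub = blk (Ab *v xb + Bb *v ub) j - A *v blk xb j - B *v blk ub j"
  using cpl[of xb j ub] by (simp add: algebra_simps)

lemma linear_cpl: "linear (\<lambda>p. cpl j (fst p) (snd p))"
  unfolding cpl_eq
  by (rule linearI) (simp_all add: linear_add[OF linear_blk] linear_scale[OF linear_blk]
      matrix_vector_right_distrib matrix_vector_mult_scaleR scaleR_add_right scaleR_diff_right)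

lemma cpl_measurable: "(\<lambda>p. cpl j (fst p) (snd p)) \<in> borel_measurable borel"
  using linear_cpl by (intro borel_measurable_continuous_onI linear_continuous_on) (simp add: linear_conv_bounded_linear)

text \<open>The measurable space \<open>N\<close> is left open: \<open>M\<close> gives plain
  measurability, and the sigma-algebra omitting the noise at time \<open>T\<close> gives
  independence.\<close>

lemma xs_us_measurable:
  assumes g: "measurable_strategy g" and X0: "\<And>i. X0 i \<in> borel_measurable N"
    and W: "\<And>s i. s < T \<Longrightarrow> W s i \<in> borel_measurable N" and \<Xi>: "\<And>s i. \<Xi> s i \<in> borel_measurable N"
  shows "t \<le> T \<Longrightarrow> (\<lambda>\<omega>. xs g t \<omega> i) \<in> borel_measurable N \<and> (\<lambda>\<omega>. us g t \<omega> i) \<in> borel_measurable N"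
proof (induction t arbitrary: i)
  case 0
  then show ?case
    using ctrl_measurable[OF g, of "\<lambda>\<omega> i. X0 i \<omega>", OF X0 \<Xi>] X0 by (simp add: acts_def)
next
  case (Suc t)
  then have IH: "(\<lambda>\<omega>. xs g t \<omega> i) \<in> borel_measurable N" "(\<lambda>\<omega>. us g t \<omega> i) \<in> borel_measurable N" for i by auto
  note d = agentwise_linear_borel_measurable[OF agentwise_linear_deep[of \<alpha>] IH(1)]
    agentwise_linear_borel_measurable[OF agentwise_linear_deep[of \<alpha>] IH(2)]
  have c: "(\<lambda>\<omega>. cpl j (deep \<alpha> (xs g t \<omega>)) (deep \<alpha> (us g t \<omega>))) \<in> borel_measurable N" for j
    using measurable_compose[OF borel_measurable_Pair[OF d] cpl_measurable[of j]] by simp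
  have x: "(\<lambda>\<omega>. xs g (Suc t) \<omega> i) \<in> borel_measurable N" for i
    unfolding xs_Suc using Suc.prems
    by (intro borel_measurable_add borel_measurable_sum borel_measurable_matrix_vector_mult IH
        borel_measurable_scaleR borel_measurable_const c W) auto
  then show ?case
    using ctrl_measurable[OF g x \<Xi>] by (simp add: acts_def)
qed

lemma measurable_in_M:
  assumes "measurable_strategy g"
  shows "(\<lambda>\<omega>. xs g t \<omega> i) \<in> borel_measurable M" "(\<lambda>\<omega>. us g t \<omega> i) \<in> borel_measurable M"
  using xs_us_measurable[OF assms, of M t t i] X0_square_integrable W_square_integrable \<Xi>_measurable
  by (auto simp: square_integrable_def)

lemma xs_square_integrable_Suc:
  assumes x: "\<And>i. square_integrable M (\<lambda>\<omega>. xs g t \<omega> i)" and u: "\<And>i. square_integrable M (\<lambda>\<omega>. us g t \<omega> i)"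
  shows "square_integrable M (\<lambda>\<omega>. xs g (Suc t) \<omega> i)"
proof -
  note d = agentwise_linear_square_integrable[OF agentwise_linear_deep[of \<alpha>] x]
    agentwise_linear_square_integrable[OF agentwise_linear_deep[of \<alpha>] u]
  have c: "square_integrable M (\<lambda>\<omega>. cpl j (deep \<alpha> (xs g t \<omega>)) (deep \<alpha> (us g t \<omega>)))" for j
  proof -
    \<comment> \<open>Linearity in the pair separates the arguments, so that each is handled by its
      own linear map.\<close>
    have e: "cpl j (deep \<alpha> (xs g t \<omega>)) (deep \<alpha> (us g t \<omega>))
        = cpl j (deep \<alpha> (xs g t \<omega>)) 0 + cpl j 0 (deep \<alpha> (us g t \<omega>))" for \<omega>
      using linear_add[OF linear_cpl, of j "(deep \<alpha> (xs g t \<omega>), 0)" "(0, deep \<alpha> (us g t \<omega>))"] by simp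
    have "linear (\<lambda>xb. (xb, 0 :: real^('z \<times> 'hu)))" "linear (\<lambda>ub. (0 :: real^('z \<times> 'hx), ub))"
      by (rule linearI, simp_all)+
    then have "linear (\<lambda>xb. cpl j xb 0)" "linear (\<lambda>ub. cpl j 0 ub)"
      using linear_compose[OF _ linear_cpl] by (force simp: comp_def)+
    then show ?thesis
      unfolding e by (intro square_integrable_add square_integrable_linear[OF d(1)] square_integrable_linear[OF d(2)])
  qed
  show ?thesis unfolding xs_Suc
    by (intro square_integrable_add square_integrable_sum square_integrable_linear[OF x]
        square_integrable_linear[OF u] square_integrable_linear[OF c] W_square_integrable
        matrix_vector_mul_linear linear_scaleR)
qed

lemma admissible_square_integrable:
  assumes "adm g"
  shows "square_integrable M (\<lambda>\<omega>. us g t \<omega> i)" "square_integrable M (\<lambda>\<omega>. xs g t \<omega> i)"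
proof -
  have m: "measurable_strategy g" using assms by (simp add: admissible_def measurable_strategy_def)
  show u: "square_integrable M (\<lambda>\<omega>. us g t \<omega> i)" for t i
    using assms measurable_in_M[OF m] by (simp add: admissible_def square_integrable_def)
  show "square_integrable M (\<lambda>\<omega>. xs g t \<omega> i)"
    by (induction t arbitrary: i) (auto simp del: traj.simps(2) simp: X0_square_integrable intro: xs_square_integrable_Suc u)
qed

text \<open>State and action at \<open>t\<close> are built from initial states, noises before
  \<open>t\<close> and randomizations, that is, from generators other than the noise at
  \<open>t\<close>.\<close>

lemma indep_noise:
  assumes g: "measurable_strategy g" and f: "agentwise_linear f" and h: "agentwise_linear h" and f': "agentwise_linear f'"
  shows "indep_var borel (\<lambda>\<omega>. F *v (f (xs g t \<omega>) :: real^'a) + G *v (h (us g t \<omega>) :: real^'b)) borel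
           (\<lambda>\<omega>. f' (\<lambda>i. W t i \<omega>) :: real^'c)"
proof (rule indep_var_rest[OF indep_prim_sets Int_stable_prim_sets])
  let ?E = "prim_sets M X0 W \<Xi>" and ?k = "Inl (Some t)"
  let ?H = "sigma (space M) (\<Union>k\<in>-{?k}. ?E k)"
  have H: "Z \<in> borel_measurable ?H" if "\<And>S. S \<in> sets borel \<Longrightarrow> Z -` S \<inter> space M \<in> ?E k" "k \<noteq> ?k"
    for Z :: "'w \<Rightarrow> 'd::euclidean_space" and k
    using that prim_sets_Pow by (intro measurable_sigma_preimages) blast+
  have comp: "(\<lambda>v::real^'hx^'n. v $ i) \<in> borel_measurable borel" for i
    by (intro borel_measurable_continuous_onI continuous_intros)
  have p: "prim X0 W q \<in> borel_measurable ?H" if "q \<noteq> Some t" for q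
    by (rule H[of _ "Inl q"]) (use that in \<open>auto simp: prim_sets_def\<close>)
  have X0: "X0 i \<in> borel_measurable ?H" for i
    using measurable_compose[OF p[of None] comp[of i]] by (simp add: prim_def)
  have W: "W s i \<in> borel_measurable ?H" if "s < t" for s i
    using measurable_compose[OF p[of "Some s"] comp[of i]] that by (simp add: prim_def)
  have \<Xi>: "\<Xi> s i \<in> borel_measurable ?H" for s i
    by (rule H[of _ "Inr (s, i)"]) (auto simp: prim_sets_def)
  have m: "(\<lambda>\<omega>. xs g t \<omega> i) \<in> borel_measurable ?H" "(\<lambda>\<omega>. us g t \<omega> i) \<in> borel_measurable ?H" for i
    using xs_us_measurable[OF g, of ?H t t i] X0 W \<Xi> by auto
  show "(\<lambda>\<omega>. F *v f (xs g t \<omega>) + G *v h (us g t \<omega>)) \<in> borel_measurable ?H"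
    using agentwise_linear_borel_measurable[OF f m(1)] agentwise_linear_borel_measurable[OF h m(2)]
    by (intro borel_measurable_add borel_measurable_matrix_vector_mult) simp_all
  have "prim X0 W (Some t) \<in> borel_measurable (sigma (space M) (?E ?k))"
    using prim_sets_Pow by (intro measurable_sigma_preimages) (auto simp: prim_sets_def)
  then have "W t i \<in> borel_measurable (sigma (space M) (?E ?k))" for i
    using measurable_compose[OF _ comp[of i], of "prim X0 W (Some t)"] by (simp add: prim_def)
  then show "(\<lambda>\<omega>. f' (\<lambda>i. W t i \<omega>)) \<in> borel_measurable (sigma (space M) (?E ?k))"
    by (rule agentwise_linear_borel_measurable[OF f'])
qed

section \<open>Expected cost, value and energy of an admissible strategy\<close>

definition c_dev where
  "c_dev g t i = expectation (\<lambda>\<omega>. qf Q (dev \<alpha> (xs g t \<omega>) i)) + expectation (\<lambda>\<omega>. qf R (dev \<alpha> (us g t \<omega>) i))"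
definition c_deep where
  "c_deep g t = expectation (\<lambda>\<omega>. qf Qb (deep \<alpha> (xs g t \<omega>))) + expectation (\<lambda>\<omega>. qf Rb (deep \<alpha> (us g t \<omega>)))"
definition c_tot where "c_tot g t = (\<Sum>i\<in>UNIV. c_dev g t i) / real CARD('n) + c_deep g t"
definition v_tot where
  "v_tot g t = (\<Sum>i\<in>UNIV. expectation (\<lambda>\<omega>. qf P (dev \<alpha> (xs g t \<omega>) i))) / real CARD('n)
    + expectation (\<lambda>\<omega>. qf Pb (deep \<alpha> (xs g t \<omega>)))"
text \<open>Free of the strategy, since noise acts additively in both subsystems; this is the term
  that cancels when two strategies are compared.\<close>

definition n_tot where
  "n_tot t = (\<Sum>i\<in>UNIV. expectation (\<lambda>\<omega>. qf P (dev \<alpha> (\<lambda>i. W t i \<omega>) i))) / real CARD('n)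
    + expectation (\<lambda>\<omega>. qf Pb (deep \<alpha> (\<lambda>i. W t i \<omega>)))"

context
  fixes g assumes g: "adm g"
begin

lemma adm_measurable: "measurable_strategy g"
  using g by (simp add: admissible_def measurable_strategy_def)

lemma sq_int:
  "square_integrable M (\<lambda>\<omega>. dev \<alpha> (xs g t \<omega>) i)" "square_integrable M (\<lambda>\<omega>. dev \<alpha> (us g t \<omega>) i)"
  "square_integrable M (\<lambda>\<omega>. deep \<alpha> (xs g t \<omega>))" "square_integrable M (\<lambda>\<omega>. deep \<alpha> (us g t \<omega>))"
  by (rule agentwise_linear_square_integrable[OF agentwise_linear_dev]
        agentwise_linear_square_integrable[OF agentwise_linear_deep],
      rule admissible_square_integrable[OF g])+

lemma noise_sq_int:
  "square_integrable M (\<lambda>\<omega>. dev \<alpha> (\<lambda>i. W t i \<omega>) i)" "square_integrable M (\<lambda>\<omega>. deep \<alpha> (\<lambda>i. W t i \<omega>))"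
  by (rule agentwise_linear_square_integrable[OF agentwise_linear_dev]
        agentwise_linear_square_integrable[OF agentwise_linear_deep],
      rule W_square_integrable)+

text \<open>References by number follow this order: Bellman inequality, Bellman equality,
  integrability of the energy, energy decay.\<close>

lemmas dev_estimates = subsystem_estimates[where Y = "\<lambda>t \<omega>. dev \<alpha> (xs g t \<omega>) i" and U = "\<lambda>t \<omega>. dev \<alpha> (us g t \<omega>) i"
    and N = "\<lambda>t \<omega>. dev \<alpha> (\<lambda>i. W t i \<omega>) i" for i, OF sq_int(1) sq_int(2) noise_sq_int(1) dev_Suc
    indep_noise[OF adm_measurable agentwise_linear_dev agentwise_linear_dev agentwise_linear_dev]
    agentwise_linear_expectation_0[OF agentwise_linear_dev W_square_integrable W_zero]]

lemmas deep_estimates = subsystem_estimates[where Y = "\<lambda>t \<omega>. deep \<alpha> (xs g t \<omega>)" and U = "\<lambda>t \<omega>. deep \<alpha> (us g t \<omega>)"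
    and N = "\<lambda>t \<omega>. deep \<alpha> (\<lambda>i. W t i \<omega>)", OF sq_int(3) sq_int(4) noise_sq_int(2) deep_Suc
    indep_noise[OF adm_measurable agentwise_linear_deep agentwise_linear_deep agentwise_linear_deep]
    agentwise_linear_expectation_0[OF agentwise_linear_deep W_square_integrable W_zero]]

lemma v_tot_le: "v_tot g t \<le> c_tot g t + \<beta> * (v_tot g (Suc t) - n_tot t)"
proof -
  have "(\<Sum>i\<in>UNIV. expectation (\<lambda>\<omega>. qf P (dev \<alpha> (xs g t \<omega>) i)))
      \<le> (\<Sum>i\<in>UNIV. c_dev g t i + \<beta> * (expectation (\<lambda>\<omega>. qf P (dev \<alpha> (xs g (Suc t) \<omega>) i))
          - expectation (\<lambda>\<omega>. qf P (dev \<alpha> (\<lambda>i. W t i \<omega>) i))))"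
    unfolding c_dev_def by (intro sum_mono dev_estimates(1)[OF symP(1) bellman(1)])
  from divide_right_mono[OF this, of "real CARD('n)"] deep_estimates(1)[OF symP(2) bellman(2), of t]
  show ?thesis
    unfolding v_tot_def c_tot_def n_tot_def c_deep_def
    by (simp add: sum.distrib sum_subtractf sum_distrib_left[symmetric] add_divide_distrib diff_divide_distrib
        distrib_left right_diff_distrib del: traj.simps)
qed

lemma v_tot_eq:
  assumes "\<And>t \<omega> i. dev \<alpha> (us g t \<omega>) i = \<theta> *v dev \<alpha> (xs g t \<omega>) i"
    "\<And>t \<omega>. deep \<alpha> (us g t \<omega>) = \<theta>b *v deep \<alpha> (xs g t \<omega>)"
  shows "v_tot g t = c_tot g t + \<beta> * (v_tot g (Suc t) - n_tot t)"
proof -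
  have "(\<Sum>i\<in>UNIV. expectation (\<lambda>\<omega>. qf P (dev \<alpha> (xs g t \<omega>) i)))
      = (\<Sum>i\<in>UNIV. c_dev g t i + \<beta> * (expectation (\<lambda>\<omega>. qf P (dev \<alpha> (xs g (Suc t) \<omega>) i))
          - expectation (\<lambda>\<omega>. qf P (dev \<alpha> (\<lambda>i. W t i \<omega>) i))))"
    unfolding c_dev_def by (intro sum.cong refl dev_estimates(2)[OF symP(1) bellman(1)] assms)
  from arg_cong[OF this, of "\<lambda>s. s / real CARD('n)"] deep_estimates(2)[OF symP(2) bellman(2) assms(2), of t]
  show ?thesis
    unfolding v_tot_def c_tot_def n_tot_def c_deep_def
    by (simp add: sum.distrib sum_subtractf sum_distrib_left[symmetric] add_divide_distrib diff_divide_distrib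
        distrib_left right_diff_distrib del: traj.simps)
qed

lemmas cost_integrable = square_integrable_qf[OF sq_int(1)] square_integrable_qf[OF sq_int(2)]
  square_integrable_qf[OF sq_int(3)] square_integrable_qf[OF sq_int(4)]

lemma stage_cost_expectation:
  "integrable M (\<lambda>\<omega>. stage_cost Q R \<alpha> cc (xs g t \<omega>) (us g t \<omega>))"
  "expectation (\<lambda>\<omega>. stage_cost Q R \<alpha> cc (xs g t \<omega>) (us g t \<omega>)) = c_tot g t"
  unfolding stage_cost_decoupled c_tot_def c_dev_def c_deep_def
  using cost_integrable by (simp_all add: Bochner_Integration.integral_sum)

lemma cost_nonneg: "0 \<le> c_dev g t i" "0 \<le> c_deep g t" "0 \<le> c_tot g t" "0 \<le> v_tot g t"
proof -
  show c: "0 \<le> c_dev g t i" "0 \<le> c_deep g t" for i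
    using psd unfolding c_dev_def c_deep_def psd_def
    by (auto intro!: add_nonneg_nonneg Bochner_Integration.integral_nonneg)
  show "0 \<le> c_tot g t" unfolding c_tot_def by (intro add_nonneg_nonneg divide_nonneg_nonneg sum_nonneg c) simp
  show "0 \<le> v_tot g t"
    using psd unfolding v_tot_def psd_def
    by (auto intro!: add_nonneg_nonneg divide_nonneg_nonneg sum_nonneg Bochner_Integration.integral_nonneg)
qed

lemma Jcost_c_tot:
  "Jcost M \<beta> A B \<alpha> cpl Q R cc X0 W \<Xi> g =
    (if \<beta> < 1 then ereal (1 - \<beta>) * (\<Sum>t. ereal (\<beta> ^ t * c_tot g t))
     else limsup (\<lambda>T. ereal ((\<Sum>t<T. c_tot g t) / real T)))"
  unfolding Jcost_def Let_def using stage_cost_expectation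
  by (simp add: Bochner_Integration.integral_sum)

text \<open>\<open>a\<close> sums the expected energies of all deviations and of the deep state. It
  is not averaged over agents, so the number of agents passes into the constants.\<close>

lemma deviation_bounds:
  obtains a \<rho> K D where "0 \<le> \<rho>" "\<rho> < 1" "0 \<le> K" "0 \<le> D" "\<And>t. 0 \<le> a t" "\<And>t. v_tot g t \<le> K * a t"
    "\<And>t. a (Suc t) \<le> \<rho> * a t + K * (c_tot g t + D)"
proof -
  obtain S1 \<rho>1 K1 S2 \<rho>2 K2 where d: "dissipative A B Q R S1 \<rho>1 K1" "dissipative Ab Bb Qb Rb S2 \<rho>2 K2"
    using dissipative by blast
  define \<rho> where "\<rho> = max \<rho>1 \<rho>2"
  define K where "K = max K1 K2"
  have \<rho>: "0 \<le> \<rho>" "\<rho> < 1" and K: "0 \<le> K" using d by (auto simp: \<rho>_def K_def dissipative_def)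
  have D1: "dissipative A B Q R S1 \<rho> K" and D2: "dissipative Ab Bb Qb Rb S2 \<rho> K"
    using psd \<rho> by (auto intro!: dissipative_mono[OF d(1)] dissipative_mono[OF d(2)] simp: \<rho>_def K_def)
  have low: "(norm x)\<^sup>2 \<le> S1 x" "(norm y)\<^sup>2 \<le> S2 y" for x y
    using D1 D2 by (auto simp: dissipative_def)
  define s1 where "s1 t i = expectation (\<lambda>\<omega>. S1 (dev \<alpha> (xs g t \<omega>) i))" for t i
  define s2 where "s2 t = expectation (\<lambda>\<omega>. S2 (deep \<alpha> (xs g t \<omega>)))" for t
  define a where "a t = (\<Sum>i\<in>UNIV. s1 t i) + s2 t" for t
  define e1 where "e1 t i = expectation (\<lambda>\<omega>. (norm (dev \<alpha> (\<lambda>i. W t i \<omega>) i))\<^sup>2)" for t i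
  define e2 where "e2 t = expectation (\<lambda>\<omega>. (norm (deep \<alpha> (\<lambda>i. W t i \<omega>)))\<^sup>2)" for t
  let ?n = "real CARD('n)"
  have n: "1 \<le> ?n" by (simp add: Suc_leI)
  have s0: "0 \<le> s1 t i" "0 \<le> s2 t" for t i
    unfolding s1_def s2_def
    by (intro Bochner_Integration.integral_nonneg order_trans[OF zero_le_power2 low(1)] order_trans[OF zero_le_power2 low(2)])+
  obtain C where C: "\<And>t i. expectation (\<lambda>\<omega>. (norm (W t i \<omega>))\<^sup>2) \<le> C" using W_bounded by blast
  \<comment> \<open>Pythagoras with the identity matrix bounds the noise energy of the subsystems by
    that of the agents, which is uniform in time.\<close>
  have e: "(\<Sum>i\<in>UNIV. e1 t i) + e2 t \<le> 2 * ?n * C" for t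
  proof -
    have "(\<Sum>i\<in>UNIV. (norm (dev \<alpha> w i))\<^sup>2) + (norm (deep \<alpha> w))\<^sup>2 \<le> 2 * (\<Sum>i\<in>UNIV. (norm (w i))\<^sup>2)"
      for w :: "'n \<Rightarrow> real^'hx"
    proof -
      have q: "qf (mat 1) v = (norm v)\<^sup>2" for v :: "real^'hx" by (simp add: qf_def power2_norm_eq_inner)
      define X Y Z where "X = (\<Sum>i\<in>UNIV. (norm (w i))\<^sup>2)" and "Y = (\<Sum>i\<in>UNIV. (norm (dev \<alpha> w i))\<^sup>2)"
        and "Z = (norm (deep \<alpha> w))\<^sup>2"
      have "Z = (\<Sum>j\<in>UNIV. (norm (blk (deep \<alpha> w) j))\<^sup>2)"
        unfolding Z_def power2_norm_eq_inner by (rule inner_blk)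
      then have "X / ?n = Y / ?n + Z"
        using sum_qf_decoupling[OF orth, of "mat 1" w] by (simp add: q X_def Y_def)
      then have "X = Y + ?n * Z" by (simp add: field_simps)
      moreover have "1 * Z \<le> ?n * Z" using n by (intro mult_right_mono) (auto simp: Z_def)
      moreover have "0 \<le> Y" by (simp add: Y_def sum_nonneg)
      moreover have "0 \<le> Z" by (simp add: Z_def)
      ultimately have "Y + Z \<le> 2 * X" by linarith
      then show ?thesis by (simp add: X_def Y_def Z_def)
    qed
    then have "expectation (\<lambda>\<omega>. (\<Sum>i\<in>UNIV. (norm (dev \<alpha> (\<lambda>i. W t i \<omega>) i))\<^sup>2) + (norm (deep \<alpha> (\<lambda>i. W t i \<omega>)))\<^sup>2)
        \<le> expectation (\<lambda>\<omega>. 2 * (\<Sum>i\<in>UNIV. (norm (W t i \<omega>))\<^sup>2))"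
      using noise_sq_int W_square_integrable by (intro integral_mono) (auto simp: square_integrable_def)
    also have "\<dots> = 2 * (\<Sum>i\<in>UNIV. expectation (\<lambda>\<omega>. (norm (W t i \<omega>))\<^sup>2))"
      using W_square_integrable by (simp add: square_integrable_def Bochner_Integration.integral_sum)
    also have "\<dots> \<le> 2 * (\<Sum>i\<in>(UNIV :: 'n set). C)" by (intro mult_left_mono sum_mono C) simp
    finally show ?thesis
      using noise_sq_int by (simp add: e1_def e2_def square_integrable_def Bochner_Integration.integral_sum)
  qed
  have "0 \<le> C" using order_trans[OF Bochner_Integration.integral_nonneg C] by (metis zero_le_power2)
  obtain KP where KP: "KP \<ge> 0" "\<And>x. qf P x \<le> KP * (norm x)\<^sup>2" using qf_le[of P] by blast
  obtain KPb where KPb: "KPb \<ge> 0" "\<And>x. qf Pb x \<le> KPb * (norm x)\<^sup>2" using qf_le[of Pb] by blast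
  \<comment> \<open>\<open>?n * K\<close> undoes the average over agents in \<open>c_tot\<close>;
    \<open>KP\<close> and \<open>KPb\<close> dominate the value by the energy.\<close>
  define K' where "K' = ?n * K + KP + KPb"
  have K': "0 \<le> K'" "?n * K \<le> K'" "KP \<le> K'" "KPb \<le> K'" using K KP(1) KPb(1) by (simp_all add: K'_def)
  have "a (Suc t) \<le> \<rho> * a t + K' * (c_tot g t + 2 * ?n * C)" for t
  proof -
    have "(\<Sum>i\<in>UNIV. s1 (Suc t) i) \<le> (\<Sum>i\<in>UNIV. \<rho> * s1 t i + K * (c_dev g t i + e1 t i))"
      unfolding s1_def c_dev_def e1_def by (intro sum_mono dev_estimates(4)[OF D1])
    moreover have "s2 (Suc t) \<le> \<rho> * s2 t + K * (c_deep g t + e2 t)"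
      unfolding s2_def c_deep_def e2_def by (rule deep_estimates(4)[OF D2])
    ultimately have "a (Suc t) \<le> \<rho> * a t + K * (((\<Sum>i\<in>UNIV. c_dev g t i) + c_deep g t) + ((\<Sum>i\<in>UNIV. e1 t i) + e2 t))"
      by (simp add: a_def sum.distrib sum_distrib_left[symmetric] algebra_simps)
    also have "\<dots> \<le> \<rho> * a t + K * (?n * (c_tot g t + 2 * ?n * C))"
    proof -
      have "(\<Sum>i\<in>UNIV. c_dev g t i) + 1 * c_deep g t \<le> (\<Sum>i\<in>UNIV. c_dev g t i) + ?n * c_deep g t"
        using n by (intro add_left_mono mult_right_mono cost_nonneg)
      also have "\<dots> = ?n * c_tot g t" by (simp add: c_tot_def field_simps)
      finally have "(\<Sum>i\<in>UNIV. c_dev g t i) + c_deep g t \<le> ?n * c_tot g t" by simp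
      moreover have "1 * (2 * ?n * C) \<le> ?n * (2 * ?n * C)"
        using n \<open>0 \<le> C\<close> by (intro mult_right_mono) auto
      ultimately have "(\<Sum>i\<in>UNIV. c_dev g t i) + c_deep g t + ((\<Sum>i\<in>UNIV. e1 t i) + e2 t)
          \<le> ?n * (c_tot g t + 2 * ?n * C)"
        using e[of t] unfolding distrib_left by linarith
      then show ?thesis using K by (intro add_left_mono mult_left_mono)
    qed
    also have "\<dots> = \<rho> * a t + (?n * K) * (c_tot g t + 2 * ?n * C)" by simp
    also have "\<dots> \<le> \<rho> * a t + K' * (c_tot g t + 2 * ?n * C)"
      using K'(2) cost_nonneg(3)[of t] \<open>0 \<le> C\<close> by (intro add_left_mono mult_right_mono) auto
    finally show ?thesis .
  qed
  moreover have "v_tot g t \<le> K' * a t" for t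
  proof -
    have q1: "qf P x \<le> K' * S1 x" for x
      using KP(2)[of x] mult_mono[OF K'(3) low(1)[of x]] K'(1) by simp
    have q2: "qf Pb x \<le> K' * S2 x" for x
      using KPb(2)[of x] mult_mono[OF K'(4) low(2)[of x]] K'(1) by simp
    have "expectation (\<lambda>\<omega>. qf P (dev \<alpha> (xs g t \<omega>) i)) \<le> expectation (\<lambda>\<omega>. K' * S1 (dev \<alpha> (xs g t \<omega>) i))" for i
      using q1 cost_integrable(1) dev_estimates(3)[OF D1] by (intro integral_mono) auto
    then have p1: "expectation (\<lambda>\<omega>. qf P (dev \<alpha> (xs g t \<omega>) i)) \<le> K' * s1 t i" for i
      by (simp add: s1_def)
    have "expectation (\<lambda>\<omega>. qf Pb (deep \<alpha> (xs g t \<omega>))) \<le> expectation (\<lambda>\<omega>. K' * S2 (deep \<alpha> (xs g t \<omega>)))"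
      using q2 cost_integrable(3) deep_estimates(3)[OF D2] by (intro integral_mono) auto
    then have p2: "expectation (\<lambda>\<omega>. qf Pb (deep \<alpha> (xs g t \<omega>))) \<le> K' * s2 t"
      by (simp add: s2_def)
    have "(\<Sum>i\<in>UNIV. expectation (\<lambda>\<omega>. qf P (dev \<alpha> (xs g t \<omega>) i))) / ?n \<le> (\<Sum>i\<in>UNIV. K' * s1 t i) / ?n"
      by (intro divide_right_mono sum_mono p1) simp
    also have "\<dots> \<le> (\<Sum>i\<in>UNIV. K' * s1 t i) / 1"
      using n by (intro divide_left_mono sum_nonneg mult_nonneg_nonneg K' s0) auto
    finally show ?thesis using p2 by (simp add: v_tot_def a_def sum_distrib_left distrib_left)
  qed
  moreover have "0 \<le> a t" for t unfolding a_def by (intro add_nonneg_nonneg sum_nonneg s0)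
  ultimately show ?thesis using that[of \<rho> K' "2 * ?n * C" a] \<rho> K'(1) \<open>0 \<le> C\<close> by simp
qed

end

section \<open>The proposed strategy: admissibility and optimality\<close>

lemma gs_controls:
  "dev \<alpha> (us gs t \<omega>) i = \<theta> *v dev \<alpha> (xs gs t \<omega>) i"
  "deep \<alpha> (us gs t \<omega>) = \<theta>b *v deep \<alpha> (xs gs t \<omega>)"
  by (rule dev_control[OF orth], simp add: acts_def ctrl_def gs)+

lemma gs_measurable: "measurable_strategy gs"
proof -
  have blk: "continuous_on UNIV (\<lambda>v. blk (v :: real^('z \<times> 'h::finite)) j)" for j
    using linear_blk by (intro linear_continuous_on) (simp add: linear_conv_bounded_linear)
  have "continuous_on UNIV (\<lambda>p. gs t i (fst p) (fst (snd p)) (snd (snd p)))" for t i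
    unfolding gs
    by (intro continuous_intros continuous_on_compose2[OF blk]
        continuous_on_compose2[OF matrix_vector_mult_linear_continuous_on[of UNIV]]) auto
  then show ?thesis
    unfolding measurable_strategy_def split_beta by (intro allI borel_measurable_continuous_onI)
qed

text \<open>Linear feedback carries square integrability from state to action, and the dynamics
  carry it from both to the next state.\<close>

lemma gs_admissible: "adm gs"
proof -
  define L where "L i j v = \<alpha> i j *\<^sub>R (blk (\<theta>b *v v) j - \<theta> *v blk v j)" for i j v
  have L: "linear (L i j)" for i j
    unfolding L_def
    by (rule linearI) (simp_all add: linear_add[OF linear_blk] linear_scale[OF linear_blk]
        matrix_vector_right_distrib matrix_vector_mult_scaleR algebra_simps)
  have us_eq: "us gs t \<omega> i = \<theta> *v xs gs t \<omega> i + (\<Sum>j\<in>UNIV. L i j (deep \<alpha> (xs gs t \<omega>)))" for t \<omega> i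
    by (simp add: acts_def ctrl_def gs L_def)
  have u: "square_integrable M (\<lambda>\<omega>. us gs t \<omega> i)" if x: "\<And>i. square_integrable M (\<lambda>\<omega>. xs gs t \<omega> i)" for t i
    unfolding us_eq
    by (intro square_integrable_add square_integrable_sum square_integrable_linear[OF x matrix_vector_mul_linear]
        square_integrable_linear[OF agentwise_linear_square_integrable[OF agentwise_linear_deep[of \<alpha>] x] L])
  have "square_integrable M (\<lambda>\<omega>. xs gs t \<omega> i)" for t i
    by (induction t arbitrary: i) (auto simp del: traj.simps(2) simp: X0_square_integrable intro: xs_square_integrable_Suc u)
  with u gs_measurable show ?thesis
    unfolding admissible_def measurable_strategy_def square_integrable_def by blast
qed

lemma gs_optimal: "optimal M \<beta> A B \<alpha> cpl Q R cc X0 W \<Xi> gs"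
  unfolding optimal_def
proof (intro conjI allI impI gs_admissible)
  fix g assume g: "adm g"
  obtain a \<rho> K D where b: "0 \<le> \<rho>" "\<rho> < 1" "0 \<le> K" "0 \<le> D" "\<And>t. 0 \<le> a t" "\<And>t. v_tot g t \<le> K * a t"
    "\<And>t. a (Suc t) \<le> \<rho> * a t + K * (c_tot g t + D)"
    by (rule deviation_bounds[OF g]) blast
  have partial: "(\<Sum>t<T. \<beta> ^ t * c_tot gs t) \<le> (\<Sum>t<T. \<beta> ^ t * c_tot g t) + \<beta> ^ T * v_tot g T" for T
  proof -
    \<comment> \<open>The nonnegative terminal value of the proposed strategy is added to reach the
      exact telescoped identity.\<close>
    have "(\<Sum>t<T. \<beta> ^ t * c_tot gs t) \<le> (\<Sum>t<T. \<beta> ^ t * c_tot gs t) + \<beta> ^ T * v_tot gs T"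
      using \<beta> cost_nonneg(4)[OF gs_admissible] by simp
    also have "\<dots> = v_tot gs 0 + (\<Sum>t<T. \<beta> ^ Suc t * n_tot t)"
      by (rule telescoped_cost_eq[of "v_tot gs" "c_tot gs" \<beta> n_tot, symmetric])
        (rule v_tot_eq[OF gs_admissible gs_controls])
    \<comment> \<open>Every trajectory starts from \<open>X0\<close>, whatever the strategy.\<close>
    also have "v_tot gs 0 = v_tot g 0" by (simp add: v_tot_def)
    also have "v_tot g 0 + (\<Sum>t<T. \<beta> ^ Suc t * n_tot t) \<le> (\<Sum>t<T. \<beta> ^ t * c_tot g t) + \<beta> ^ T * v_tot g T"
      using \<beta> by (intro telescoped_cost_le v_tot_le[OF g]) auto
    finally show ?thesis .
  qed
  interpret cost_comparison "c_tot gs" "c_tot g" "v_tot g" a \<beta> \<rho> K D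
    using \<beta> b partial cost_nonneg(3)[OF gs_admissible] cost_nonneg(3,4)[OF g] by unfold_locales
  show "Jcost M \<beta> A B \<alpha> cpl Q R cc X0 W \<Xi> gs \<le> Jcost M \<beta> A B \<alpha> cpl Q R cc X0 W \<Xi> g"
  proof (cases "\<beta> < 1")
    case True
    then show ?thesis
      unfolding Jcost_c_tot[OF g] Jcost_c_tot[OF gs_admissible]
      using discounted_le by (simp add: ereal_mult_left_mono)
  next
    case False
    then show ?thesis
      unfolding Jcost_c_tot[OF g] Jcost_c_tot[OF gs_admissible]
      using average_le \<beta> by simp
  qed
qed

end

theorem theorem2:
  fixes M :: "'w measure"
    and \<alpha> :: "'n::finite \<Rightarrow> 'z::finite \<Rightarrow> real"
    and \<beta> :: real
    and A :: "real^'hx::finite^'hx" and B :: "real^'hu::finite^'hx"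
    and Q :: "real^'hx^'hx" and R :: "real^'hu^'hu" and P :: "real^'hx^'hx"
    and X0 :: "'n \<Rightarrow> 'w \<Rightarrow> real^'hx" and W :: "nat \<Rightarrow> 'n \<Rightarrow> 'w \<Rightarrow> real^'hx"
    and \<Xi> :: "nat \<Rightarrow> 'n \<Rightarrow> 'w \<Rightarrow> real"
  assumes "prob_space M"
    and "primitives_ok M X0 W \<Xi>"
    and "\<forall>j k. (\<Sum>i\<in>UNIV. \<alpha> i j * \<alpha> i k) / real CARD('n) = (if j = k then 1 else 0)"
    and "0 < \<beta>" and "\<beta> \<le> 1"
    and "symm Q" and "symm R" and "psd Q" and "pd R"
    and "stabilizable A B" and "detectable A (msqrt Q)"
    and "symm P" and "psd P" and "riccati \<beta> A B Q R P"
  shows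
    "(\<forall>(Ab :: 'z \<Rightarrow> real^('z \<times> 'hx)^'hx) (Bb :: 'z \<Rightarrow> real^('z \<times> 'hu)^'hx)
        (Qb :: real^('z \<times> 'hx)^('z \<times> 'hx)) (Rb :: real^('z \<times> 'hu)^('z \<times> 'hu))
        (Pb :: real^('z \<times> 'hx)^('z \<times> 'hx)).
        symm Qb \<and> symm Rb \<and> psd (bdiag Q + Qb) \<and> pd (bdiag R + Rb)
        \<and> stabilizable (bold A Ab) (bold B Bb)
        \<and> detectable (bold A Ab) (msqrt (bdiag Q + Qb))
        \<and> symm Pb \<and> psd Pb \<and> riccati \<beta> (bold A Ab) (bold B Bb) (bdiag Q + Qb) (bdiag R + Rb) Pb
        \<longrightarrow> optimal M \<beta> A B \<alpha> (\<lambda>j xb ub. Ab j *v xb + Bb j *v ub) Q R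
              (\<lambda>xb ub. qf Qb xb + qf Rb ub) X0 W \<Xi>
              (gstar \<alpha> (gain \<beta> A B R P) (gain \<beta> (bold A Ab) (bold B Bb) (bdiag R + Rb) Pb)))
     \<and>
     (\<forall>(Aw :: 'z \<Rightarrow> real^'hx^'hx) (Bw :: 'z \<Rightarrow> real^'hu^'hx)
        (Qw :: 'z \<Rightarrow> real^'hx^'hx) (Rw :: 'z \<Rightarrow> real^'hu^'hu) (Pw :: 'z \<Rightarrow> real^'hx^'hx).
        (\<forall>j. symm (Qw j) \<and> symm (Rw j))
        \<and> psd (bdiagf (\<lambda>j. Q + Qw j)) \<and> pd (bdiagf (\<lambda>j. R + Rw j))
        \<and> stabilizable (bdiagf (\<lambda>j. A + Aw j)) (bdiagf (\<lambda>j. B + Bw j))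
        \<and> detectable (bdiagf (\<lambda>j. A + Aw j)) (msqrt (bdiagf (\<lambda>j. Q + Qw j)))
        \<and> (\<forall>j. symm (Pw j) \<and> psd (Pw j)
               \<and> riccati \<beta> (A + Aw j) (B + Bw j) (Q + Qw j) (R + Rw j) (Pw j))
        \<longrightarrow> optimal M \<beta> A B \<alpha> (\<lambda>j xb ub. Aw j *v blk xb j + Bw j *v blk ub j) Q R
              (\<lambda>xb ub. \<Sum>j\<in>UNIV. qf (Qw j) (blk xb j) + qf (Rw j) (blk ub j)) X0 W \<Xi>
              (gstar_weak \<alpha> (gain \<beta> A B R P)
                 (\<lambda>j. gain \<beta> (A + Aw j) (B + Bw j) (R + Rw j) (Pw j))))"
proof (intro conjI allI impI, goal_cases)
  have orth: "orthonormal_factors \<alpha>" using assms(3) by (simp add: orthonormal_factors_def)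
  have psdR: "psd R" using assms(9) by (rule pd_imp_psd)
  have bell: "bellman \<beta> A B Q R P (gain \<beta> A B R P)" using assms by (intro riccati_bellman)
  have diss: "\<exists>S \<rho> K. dissipative A B Q R S \<rho> K"
    using detectable_dissipative[OF assms(6,8,9,11)] by blast
  {
    case (1 Ab Bb Qb Rb Pb)
    then have s: "symm (bdiag Q + Qb)" "symm (bdiag R + Rb)"
      using assms(6,7) unfolding bdiag_def by (auto intro!: symm_add symm_bdiagf)
    have "\<exists>S \<rho> K. dissipative (bold A Ab) (bold B Bb) (bdiag Q + Qb) (bdiag R + Rb) S \<rho> K"
      using detectable_dissipative[OF s(1)] 1 by metis
    moreover have "bellman \<beta> (bold A Ab) (bold B Bb) (bdiag Q + Qb) (bdiag R + Rb) Pb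
        (gain \<beta> (bold A Ab) (bold B Bb) (bdiag R + Rb) Pb)"
      using 1 s assms(4) by (intro riccati_bellman) auto
    ultimately interpret lq_team M \<alpha> \<beta> A B Q R P "gain \<beta> A B R P" X0 W \<Xi> "\<lambda>j xb ub. Ab j *v xb + Bb j *v ub"
      "\<lambda>xb ub. qf Qb xb + qf Rb ub" "bold A Ab" "bold B Bb" "bdiag Q + Qb" "bdiag R + Rb" Pb
      "gain \<beta> (bold A Ab) (bold B Bb) (bdiag R + Rb) Pb"
      "gstar \<alpha> (gain \<beta> A B R P) (gain \<beta> (bold A Ab) (bold B Bb) (bdiag R + Rb) Pb)"
      using assms 1 orth psdR bell diss
      by (intro lq_team.intro lq_team_axioms.intro)
         (simp_all add: pd_imp_psd blk_add blk_bold gstar_def qf_add_matrix bdiag_def qf_bdiagf)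
    show ?case by (rule gs_optimal)
  next
    case (2 Aw Bw Qw Rw Pw)
    then have s: "symm (bdiagf (\<lambda>j. Q + Qw j))"
      using assms(6) by (intro symm_bdiagf symm_add) auto
    have pdR: "pd (R + Rw j)" for j using 2 pd_bdiagf_block[of "\<lambda>j. R + Rw j" j] by blast
    have "\<exists>S \<rho> K. dissipative (bdiagf (\<lambda>j. A + Aw j)) (bdiagf (\<lambda>j. B + Bw j)) (bdiagf (\<lambda>j. Q + Qw j))
        (bdiagf (\<lambda>j. R + Rw j)) S \<rho> K"
      using detectable_dissipative[OF s] 2 by metis
    moreover have "bellman \<beta> (bdiagf (\<lambda>j. A + Aw j)) (bdiagf (\<lambda>j. B + Bw j)) (bdiagf (\<lambda>j. Q + Qw j))
        (bdiagf (\<lambda>j. R + Rw j)) (bdiagf Pw) (bdiagf (\<lambda>j. gain \<beta> (A + Aw j) (B + Bw j) (R + Rw j) (Pw j)))"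
      using 2 assms(4,7) pdR by (intro bellman_bdiagf riccati_bellman symm_add) auto
    moreover have "symm (bdiagf Pw)" "psd (bdiagf Pw)"
      using 2 by (auto intro!: symm_bdiagf sum_nonneg simp: psd_def qf_bdiagf)
    \<comment> \<open>The block-diagonal gain acts on each block separately, which turns the general
      feedback into \<open>gstar_weak\<close>.\<close>
    ultimately interpret lq_team M \<alpha> \<beta> A B Q R P "gain \<beta> A B R P" X0 W \<Xi>
      "\<lambda>j xb ub. Aw j *v blk xb j + Bw j *v blk ub j"
      "\<lambda>xb ub. \<Sum>j\<in>UNIV. qf (Qw j) (blk xb j) + qf (Rw j) (blk ub j)"
      "bdiagf (\<lambda>j. A + Aw j)" "bdiagf (\<lambda>j. B + Bw j)" "bdiagf (\<lambda>j. Q + Qw j)" "bdiagf (\<lambda>j. R + Rw j)"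
      "bdiagf Pw" "bdiagf (\<lambda>j. gain \<beta> (A + Aw j) (B + Bw j) (R + Rw j) (Pw j))"
      "gstar_weak \<alpha> (gain \<beta> A B R P) (\<lambda>j. gain \<beta> (A + Aw j) (B + Bw j) (R + Rw j) (Pw j))"
      using assms 2 orth psdR bell diss
      by (intro lq_team.intro lq_team_axioms.intro)
         (simp_all add: pd_imp_psd blk_add blk_bdiagf gstar_weak_def qf_add_matrix qf_bdiagf sum.distrib
           matrix_vector_mult_add_rdistrib matrix_vector_mult_diff_rdistrib)
    show ?case by (rule gs_optimal)
  }
qed

end
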